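(* Let $\gamma:S^n\to\mathbb R_{>0}$ be of class $C^2$. Then the mean curvature $H$ of the Cahn-Hoffman map $\xi_\gamma:S^n\to\mathbb R^{n+1}$ is defined on $S^n\setminus S(\xi_\gamma)$, and its improper integral $\int_{S^n\setminus S(\xi_\gamma)}H\,dA$ converges.
   Context: $S^n$ is the unit sphere in $\mathbb R^{n+1}$. The Cahn-Hoffman map is $\xi_\gamma(\nu)=D\gamma|_\nu+\gamma(\nu)\nu$, where $D\gamma$ is the gradient of $\gamma$ on $S^n$ and $T_\nu S^n$ is regarded as a linear subspace of $\mathbb R^{n+1}$. $S(\xi_\gamma)$ is the set of points of $S^n$ where $\xi_\gamma$ is not an immersion. At regular points $\nu$ is itself a unit normal of $\xi_\gamma$, the unit normal field is locally the inverse of $\xi_\gamma$ (hence $C^1$), the principal curvatures are the eigenvalues $\mu_1,\dots,\mu_n$ of minus its differential, and $H=\frac1n(\mu_1+\dots+\mu_n)$. $dA$ is the $n$-dimensional volume form induced by $\xi_\gamma$. *)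

theory Defs
  imports "HOL-Analysis.Analysis" "Jordan_Normal_Form.Determinant"
begin

no_notation scalar_prod (infix \<open>\<bullet>\<close> 70)

text \<open>The ambient space \<open>\<real>\<^sup>n\<^sup>+\<^sup>1\<close> is a Euclidean space \<open>'a\<close> with \<open>DIM('a) = n + 1\<close>, and
  \<open>S\<^sup>n\<close> is \<open>sphere 0 1\<close>. Maps on \<open>S\<^sup>n\<close> are total functions on \<open>'a\<close>; only their values on
  the sphere enter the definitions below.\<close>

definition C1_on_open :: "'a::real_normed_vector set \<Rightarrow> ('a \<Rightarrow> 'b::real_normed_vector) \<Rightarrow> bool" where
  "C1_on_open U F \<longleftrightarrow> (\<exists>F' :: 'a \<Rightarrow> 'a \<Rightarrow>\<^sub>L 'b.
     (\<forall>x\<in>U. (F has_derivative blinfun_apply (F' x)) (at x)) \<and> continuous_on U F')"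

definition C2_on_open :: "'a::real_normed_vector set \<Rightarrow> ('a \<Rightarrow> 'b::real_normed_vector) \<Rightarrow> bool" where
  "C2_on_open U F \<longleftrightarrow> (\<exists>F' :: 'a \<Rightarrow> 'a \<Rightarrow>\<^sub>L 'b.
     (\<forall>x\<in>U. (F has_derivative blinfun_apply (F' x)) (at x)) \<and> C1_on_open U F')"

text \<open>On a submanifold \<open>M\<close> of a Euclidean space, being of class \<open>C\<^sup>k\<close> means being locally the
  restriction of a \<open>C\<^sup>k\<close> map of the ambient space.\<close>

definition C1_on_submanifold :: "'a::euclidean_space set \<Rightarrow> ('a \<Rightarrow> 'b::real_normed_vector) \<Rightarrow> bool" where
  "C1_on_submanifold M f \<longleftrightarrow>
     (\<forall>p\<in>M. \<exists>U F. open U \<and> p \<in> U \<and> C1_on_open U F \<and> (\<forall>x\<in>U \<inter> M. F x = f x))"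

definition C2_on_submanifold :: "'a::euclidean_space set \<Rightarrow> ('a \<Rightarrow> 'b::real_normed_vector) \<Rightarrow> bool" where
  "C2_on_submanifold M f \<longleftrightarrow>
     (\<forall>p\<in>M. \<exists>U F. open U \<and> p \<in> U \<and> C2_on_open U F \<and> (\<forall>x\<in>U \<inter> M. F x = f x))"

definition sphere_tangent :: "'a::euclidean_space \<Rightarrow> 'a set" where
  "sphere_tangent \<nu> = {v. v \<bullet> \<nu> = 0}"

definition sphere_gradient :: "('a::euclidean_space \<Rightarrow> real) \<Rightarrow> 'a \<Rightarrow> 'a" where
  "sphere_gradient \<gamma> \<nu> = (THE g. g \<in> sphere_tangent \<nu> \<and>
     (\<gamma> has_derivative (\<lambda>v. g \<bullet> v)) (at \<nu> within sphere 0 1))"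

definition cahn_hoffman :: "('a::euclidean_space \<Rightarrow> real) \<Rightarrow> 'a \<Rightarrow> 'a" where
  "cahn_hoffman \<gamma> \<nu> = sphere_gradient \<gamma> \<nu> + \<gamma> \<nu> *\<^sub>R \<nu>"

text \<open>A derivative within the sphere is unique only on tangent vectors (the library's
  \<open>frechet_derivative\<close> chooses one), so it is only ever evaluated on \<open>sphere_tangent \<nu>\<close>.\<close>

definition sphere_diff ::
    "('a::euclidean_space \<Rightarrow> 'b::real_normed_vector) \<Rightarrow> 'a \<Rightarrow> 'a \<Rightarrow> 'b" where
  "sphere_diff f \<nu> = frechet_derivative f (at \<nu> within sphere 0 1)"

definition immersion_at :: "('a::euclidean_space \<Rightarrow> 'b::real_normed_vector) \<Rightarrow> 'a \<Rightarrow> bool" where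
  "immersion_at f \<nu> \<longleftrightarrow> f differentiable (at \<nu> within sphere 0 1) \<and>
     inj_on (sphere_diff f \<nu>) (sphere_tangent \<nu>)"

definition singular_set :: "('a::euclidean_space \<Rightarrow> 'b::real_normed_vector) \<Rightarrow> 'a set" where
  "singular_set f = {\<nu>\<in>sphere 0 1. \<not> immersion_at f \<nu>}"

text \<open>\<open>N\<close> is the unit normal field, defined on the hypersurface piece \<open>f ` (U \<inter> S\<^sup>n)\<close>, whose value
  at \<open>f x\<close> is \<open>x\<close>. The first conjunct on \<open>x\<close> makes \<open>N\<close> the inverse of \<open>f\<close> on \<open>U \<inter> S\<^sup>n\<close> (and
  the normal a unit vector); the second says that it is normal to the piece.\<close>

definition local_unit_normal ::
    "('a::euclidean_space \<Rightarrow> 'a) \<Rightarrow> 'a \<Rightarrow> 'a set \<Rightarrow> ('a \<Rightarrow> 'a) \<Rightarrow> bool" where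
  "local_unit_normal f \<nu> U N \<longleftrightarrow> open U \<and> \<nu> \<in> U \<and>
     (\<forall>x\<in>U \<inter> sphere 0 1. N (f x) = x \<and>
        (\<forall>v\<in>sphere_tangent x. N (f x) \<bullet> sphere_diff f x v = 0)) \<and>
     C1_on_submanifold (f ` (U \<inter> sphere 0 1)) N"

text \<open>\<open>\<mu> 1, \<dots>, \<mu> n\<close> are the eigenvalues, repeated according to multiplicity, of \<open>- dN\<close> on the
  tangent space of the hypersurface at \<open>f \<nu>\<close>, i.e. on the image of \<open>sphere_tangent \<nu>\<close> under the
  differential of \<open>f\<close>.\<close>

definition principal_curvatures :: "('a::euclidean_space \<Rightarrow> 'a) \<Rightarrow> 'a \<Rightarrow> (nat \<Rightarrow> real) \<Rightarrow> bool" where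
  "principal_curvatures f \<nu> \<mu> \<longleftrightarrow> (\<exists>U N. local_unit_normal f \<nu> U N \<and>
     (let dN = frechet_derivative N (at (f \<nu>) within f ` (U \<inter> sphere 0 1)) in
      \<forall>c. card {i\<in>{1..DIM('a) - 1}. \<mu> i = c} =
          dim {w \<in> sphere_diff f \<nu> ` sphere_tangent \<nu>. - dN w = c *\<^sub>R w}))"

definition has_mean_curvature :: "('a::euclidean_space \<Rightarrow> 'a) \<Rightarrow> 'a \<Rightarrow> real \<Rightarrow> bool" where
  "has_mean_curvature f \<nu> h \<longleftrightarrow> (\<exists>\<mu>. principal_curvatures f \<nu> \<mu> \<and>
     h = (\<Sum>i=1..DIM('a) - 1. \<mu> i) / real (DIM('a) - 1))"

definition mean_curvature :: "('a::euclidean_space \<Rightarrow> 'a) \<Rightarrow> 'a \<Rightarrow> real" where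
  "mean_curvature f \<nu> = (THE h. has_mean_curvature f \<nu> h)"

text \<open>Surface measure of \<open>S\<^sup>n\<close>, as a Borel measure on the ambient space concentrated on the sphere:
  the measure of \<open>A \<subseteq> S\<^sup>n\<close> is \<open>n + 1\<close> times the Lebesgue measure of the cone
  \<open>{r x | 0 < r \<le> 1, x \<in> A}\<close>. Recall \<open>sgn x = x /\<^sub>R norm x\<close>.\<close>

definition sphere_measure :: "'a::euclidean_space measure" where
  "sphere_measure = scale_measure (of_nat DIM('a))
     (distr (restrict_space lborel (cball 0 1 - {0})) borel sgn)"

definition orthonormal_frame :: "'a::euclidean_space \<Rightarrow> (nat \<Rightarrow> 'a) \<Rightarrow> bool" where
  "orthonormal_frame \<nu> e \<longleftrightarrow> (\<forall>i<DIM('a) - 1. e i \<in> sphere_tangent \<nu>) \<and>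
     (\<forall>i<DIM('a) - 1. \<forall>j<DIM('a) - 1. e i \<bullet> e j = (if i = j then 1 else 0))"

text \<open>Density of the volume of the pulled-back metric \<open>g(v, w) = df v \<bullet> df w\<close> with respect to the
  round metric: \<open>sqrt (det g(e\<^sub>i, e\<^sub>j))\<close> in any orthonormal frame of the tangent space.\<close>

definition volume_density :: "('a::euclidean_space \<Rightarrow> 'b::real_inner) \<Rightarrow> 'a \<Rightarrow> real" where
  "volume_density f \<nu> = (let e = (SOME e. orthonormal_frame \<nu> e) in
     sqrt (Determinant.det (Matrix.mat (DIM('a) - 1) (DIM('a) - 1)
       (\<lambda>(i, j). sphere_diff f \<nu> (e i) \<bullet> sphere_diff f \<nu> (e j)))))"

text \<open>The volume \<open>dA\<close> induced by \<open>f\<close> on the set of points of the sphere where \<open>f\<close> is an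
  immersion (elsewhere there is no induced Riemannian metric).\<close>

definition induced_volume :: "('a::euclidean_space \<Rightarrow> 'b::real_inner) \<Rightarrow> 'a measure" where
  "induced_volume f = density sphere_measure
     (\<lambda>\<nu>. ennreal (volume_density f \<nu>) * indicator (sphere 0 1 - singular_set f) \<nu>)"

definition compact_exhaustion :: "'a::topological_space set \<Rightarrow> (nat \<Rightarrow> 'a set) \<Rightarrow> bool" where
  "compact_exhaustion R K \<longleftrightarrow> (\<forall>j. compact (K j)) \<and>
     (\<forall>j. K j \<subseteq> top_of_set R interior_of K (Suc j)) \<and> (\<Union>j. K j) = R"

text \<open>Improper integral over a locally compact set \<open>R\<close>: the integrals over compact subsets exist, and
  along all exhaustions of \<open>R\<close> by compact sets they tend to one and the same real number.\<close>

definition improper_integral_converges ::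
    "'a::topological_space measure \<Rightarrow> 'a set \<Rightarrow> ('a \<Rightarrow> real) \<Rightarrow> bool" where
  "improper_integral_converges M R f \<longleftrightarrow>
     (\<forall>K. compact K \<and> K \<subseteq> R \<longrightarrow> set_integrable M K f) \<and>
     (\<exists>I. \<forall>K. compact_exhaustion R K \<longrightarrow> (\<lambda>j. set_lebesgue_integral M (K j) f) \<longlonglongrightarrow> I)"

end

theory Submission
  imports Defs
begin

text \<open>At a regular point the Cahn-Hoffman map \<open>\<xi>\<close> is parametrised by its own unit normal, so the
  differential \<open>A\<close> of \<open>\<xi>\<close> at \<open>\<nu>\<close> is an endomorphism of the tangent space \<open>\<nu>\<^sup>\<bottom>\<close>. It is the tangential part of
  the Hessian of \<open>\<gamma>\<close> plus a multiple of the identity, hence self-adjoint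
  (\<open>hedgehog_cahn_hoffman\<close>; this rests on the symmetry of second derivatives). Let \<open>l 0, \<dots>, l (n - 1)\<close> be
  its eigenvalues, the principal radii. The point is regular iff none of them is zero.

  The unit normal field inverts \<open>\<xi>\<close> locally, so its differential is \<open>A\<^sup>-\<^sup>1\<close> and the principal curvatures
  are \<open>- 1 / l i\<close>. That such a \<open>C\<^sup>1\<close> field exists is the inverse function theorem applied to an extension
  of \<open>\<xi>\<close> to the ambient space (\<open>local_unit_normal_exists\<close>). As eigenvalues with multiplicity
  determine their sum, \<open>H = - (1/n) \<Sum>i. 1 / l i\<close> is well defined (\<open>has_mean_curvature_iff\<close>).

  The volume density is the absolute value of the product of the principal radii. Multiplying it with
  \<open>H\<close> cancels every denominator, and \<open>H\<close> times the density is bounded by a sum of products of \<open>n - 1\<close>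
  principal radii, each of which is at most the norm of a continuous operator field on the compact
  sphere (\<open>mean_curvature_times_density_bounded\<close>). So \<open>H dA\<close> is absolutely integrable over the whole
  regular set (\<open>set_integrable_mean_curvature\<close>), and the improper integral converges to the Lebesgue integral
  along every exhaustion by dominated convergence.\<close>

section \<open>Self-adjoint operators on a subspace\<close>

definition orthonormal_family :: "nat \<Rightarrow> (nat \<Rightarrow> 'a::real_inner) \<Rightarrow> bool" where
  "orthonormal_family m b \<longleftrightarrow> (\<forall>i<m. \<forall>j<m. b i \<bullet> b j = (if i = j then 1 else 0))"

lemma orthonormal_familyD:
  assumes "orthonormal_family m b" "i < m" "j < m"
  shows "b i \<bullet> b j = (if i = j then 1 else 0)"
  using assms unfolding orthonormal_family_def by blast

lemma orthonormal_family_inj_on: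
  assumes "orthonormal_family m b"
  shows "inj_on b {..<m}"
proof (rule inj_onI)
  fix i j assume "i \<in> {..<m}" "j \<in> {..<m}" "b i = b j"
  then show "i = j"
    using orthonormal_familyD[OF assms, of i i] orthonormal_familyD[OF assms, of i j]
    by (auto split: if_splits)
qed

lemma orthonormal_family_independent:
  fixes b :: "nat \<Rightarrow> 'a::euclidean_space"
  assumes "orthonormal_family m b" "I \<subseteq> {..<m}"
  shows "independent (b ` I)"
proof (rule pairwise_orthogonal_independent)
  show "pairwise real_inner_class.orthogonal (b ` I)"
    using assms orthonormal_familyD[OF assms(1)]
    by (auto simp: pairwise_def real_inner_class.orthogonal_def subset_iff split: if_splits)
  show "0 \<notin> b ` I"
  proof
    assume "0 \<in> b ` I"
    then obtain i where "i \<in> I" "b i = 0" by auto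
    then show False using orthonormal_familyD[OF assms(1), of i i] assms(2) by auto
  qed
qed

lemma orthonormal_family_spans:
  fixes b :: "nat \<Rightarrow> 'a::euclidean_space"
  assumes "orthonormal_family (dim T) b" "\<And>i. i < dim T \<Longrightarrow> b i \<in> T"
  shows "T \<subseteq> span (b ` {..<dim T})"
proof (rule card_ge_dim_independent)
  show "b ` {..<dim T} \<subseteq> T" using assms(2) by auto
  show "independent (b ` {..<dim T})"
    by (rule orthonormal_family_independent[OF assms(1)]) simp
  show "dim T \<le> card (b ` {..<dim T})"
    by (simp add: card_image orthonormal_family_inj_on[OF assms(1)])
qed

lemma orthonormal_family_expansion:
  fixes b :: "nat \<Rightarrow> 'a::euclidean_space"
  assumes b: "orthonormal_family (dim T) b" "\<And>i. i < dim T \<Longrightarrow> b i \<in> T" and x: "x \<in> T"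
  shows "x = (\<Sum>i<dim T. (x \<bullet> b i) *\<^sub>R b i)"
proof -
  let ?B = "b ` {..<dim T}"
  have "(\<Sum>v\<in>?B. (x \<bullet> v) *\<^sub>R v) = x"
  proof (rule orthonormal_basis_expand)
    show "pairwise real_inner_class.orthogonal ?B"
      using orthonormal_familyD[OF b(1)]
      by (auto simp: pairwise_def real_inner_class.orthogonal_def split: if_splits)
    show "norm v = 1" if "v \<in> ?B" for v
      using that orthonormal_familyD[OF b(1)] by (auto simp: norm_eq_1)
    show "x \<in> span ?B" using orthonormal_family_spans[OF b] x by blast
  qed simp
  then show ?thesis
    by (simp add: sum.reindex orthonormal_family_inj_on[OF b(1)])
qed

text \<open>The Rayleigh quotient: \<open>A x \<bullet> x\<close> attains its maximum over the unit sphere of \<open>T\<close> at some \<open>u\<close>.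
  The first variation at \<open>u\<close> in a direction \<open>w \<bottom> u\<close> is \<open>2 (A u \<bullet> w)\<close>, so \<open>A u\<close> is orthogonal to
  every such \<open>w\<close> in \<open>T\<close> and hence a multiple of \<open>u\<close>.\<close>

lemma eigenvector_exists:
  fixes A :: "'a::euclidean_space \<Rightarrow> 'a"
  assumes A: "linear A" and T: "subspace T" "A ` T \<subseteq> T"
    and sym: "\<And>v w. v \<in> T \<Longrightarrow> w \<in> T \<Longrightarrow> A v \<bullet> w = v \<bullet> A w" and dim: "dim T > 0"
  shows "\<exists>u\<in>T. norm u = 1 \<and> A u = (A u \<bullet> u) *\<^sub>R u"
proof -
  interpret A: linear A by (rule A)
  have bl: "bounded_linear A" using A linear_conv_bounded_linear by blast
  obtain v where v: "v \<in> T" "v \<noteq> 0"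
  proof -
    have "\<not> T \<subseteq> {0}" using dim by (metis dim_eq_0 less_irrefl)
    then show ?thesis using that by blast
  qed
  have "compact (T \<inter> sphere 0 1)"
    by (intro closed_Int_compact closed_subspace T) auto
  moreover have "v /\<^sub>R norm v \<in> T \<inter> sphere 0 1"
    using v T(1) by (auto simp: subspace_scale)
  moreover have "continuous_on (T \<inter> sphere 0 1) (\<lambda>x. A x \<bullet> x)"
    by (intro continuous_intros bounded_linear.continuous_on[OF bl])
  ultimately obtain u where u: "u \<in> T \<inter> sphere 0 1"
    and max: "\<And>x. x \<in> T \<inter> sphere 0 1 \<Longrightarrow> A x \<bullet> x \<le> A u \<bullet> u"
    using continuous_attains_sup[of "T \<inter> sphere 0 1" "\<lambda>x. A x \<bullet> x"] by blast
  define m where "m = A u \<bullet> u"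
  have uu: "u \<bullet> u = 1" using u by (simp add: norm_eq_1)
  have uT: "u \<in> T" using u by simp
  have max': "A x \<bullet> x \<le> m * (x \<bullet> x)" if "x \<in> T" for x
  proof (cases "x = 0")
    case False
    have "x /\<^sub>R norm x \<in> T \<inter> sphere 0 1"
      using that False T(1) by (auto simp: subspace_scale)
    from max[OF this] have "(A x \<bullet> x) / (norm x * norm x) \<le> m"
      by (simp add: A.scale m_def divide_simps)
    then show ?thesis using False
      by (simp add: divide_simps dot_square_norm power2_eq_square split: if_splits)
  qed (simp add: A.zero)
  have orth: "A u \<bullet> w = 0" if w: "w \<in> T" "w \<bullet> u = 0" for w
  proof (rule ccontr)
    assume ne: "A u \<bullet> w \<noteq> 0"
    define c where "c = A u \<bullet> w"
    define d where "d = \<bar>m * (w \<bullet> w) - A w \<bullet> w\<bar> + 1"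
    have d: "d > 0" unfolding d_def by linarith
    \<comment> \<open>With this \<open>t\<close> the gain \<open>2 t c\<close> in the Rayleigh quotient exceeds the quadratic loss \<open>t\<^sup>2 d\<close>.\<close>
    define t where "t = c / d"
    have "u + t *\<^sub>R w \<in> T" using uT w T(1) by (simp add: subspace_add subspace_scale)
    from max'[OF this] have "m + 2 * t * c + t\<^sup>2 * (A w \<bullet> w) \<le> m * (1 + t\<^sup>2 * (w \<bullet> w))"
      using sym[OF w(1) uT] w(2) uu
      by (simp add: A.add A.scale inner_simps m_def c_def inner_commute algebra_simps
          power2_eq_square)
    then have "2 * t * c \<le> t\<^sup>2 * (m * (w \<bullet> w) - A w \<bullet> w)" by (simp add: algebra_simps)
    also have "\<dots> \<le> t\<^sup>2 * d" unfolding d_def by (intro mult_left_mono) auto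
    finally have "2 * (c * c) / d \<le> (c * c) / d"
      using d unfolding t_def by (simp add: power2_eq_square field_simps)
    then have "c * c \<le> 0" using d by (simp add: field_simps)
    then have "c = 0" by (metis mult_eq_0_iff order_antisym zero_le_square)
    then show False using ne unfolding c_def by simp
  qed
  let ?r = "A u - m *\<^sub>R u"
  have rT: "?r \<in> T" using T uT by (auto intro!: subspace_diff subspace_scale)
  have ru: "?r \<bullet> u = 0" using uu by (simp add: inner_simps m_def)
  have "?r \<bullet> ?r = A u \<bullet> ?r - m * (u \<bullet> ?r)"
    by (simp only: inner_diff_left[of "A u"] inner_scaleR_left)
  also have "\<dots> = 0" using orth[OF rT ru] ru by (simp add: inner_commute)
  finally have "A u = m *\<^sub>R u" by simp
  then show ?thesis using u uT unfolding m_def by (auto intro!: bexI[of _ u])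
qed

text \<open>By induction on the dimension: symmetry of \<open>A\<close> makes the orthogonal complement of an eigenvector
  invariant again. The theorem is stated on a subspace because it is applied to the tangent spaces
  of the sphere, whose dimension is not that of a type.\<close>

lemma spectral_theorem_subspace:
  fixes A :: "'a::euclidean_space \<Rightarrow> 'a"
  assumes A: "linear A" and T: "subspace T" "A ` T \<subseteq> T"
    and sym: "\<And>v w. v \<in> T \<Longrightarrow> w \<in> T \<Longrightarrow> A v \<bullet> w = v \<bullet> A w"
  shows "\<exists>b l. orthonormal_family (dim T) b \<and>
           (\<forall>i<dim T. b i \<in> T \<and> A (b i) = l i *\<^sub>R b i)"
  using T sym
proof (induction "dim T" arbitrary: T)
  case 0
  have "orthonormal_family (dim T) (\<lambda>_. 0 :: 'a)" "\<not> i < dim T" for i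
    unfolding "0.hyps"[symmetric] by (simp_all add: orthonormal_family_def)
  then show ?case by blast
next
  case (Suc k)
  obtain u where u: "u \<in> T" "norm u = 1" "A u = (A u \<bullet> u) *\<^sub>R u"
    using eigenvector_exists[OF A Suc.prems(1,2)] Suc.prems(3) Suc.hyps(2) by fastforce
  define W where "W = {y \<in> T. \<forall>x\<in>span {u}. real_inner_class.orthogonal x y}"
  have W: "W = {y \<in> T. u \<bullet> y = 0}"
    unfolding W_def by (auto simp: real_inner_class.orthogonal_def span_singleton)
  have "dim W + dim (span {u}) = dim T"
    unfolding W_def using Suc.prems(1) u(1)
    by (intro dim_subspace_orthogonal_to_vectors) (auto simp: span_minimal)
  moreover have "dim (span {u}) = 1"
    using u(2) by (metis dim_singleton dim_span norm_zero zero_neq_one)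
  ultimately have dW: "dim W = k" using Suc.hyps(2) by simp
  have sW: "subspace W"
    unfolding W using Suc.prems(1)
    by (auto simp: subspace_def inner_simps)
  have AW: "A ` W \<subseteq> W"
  proof
    fix z assume "z \<in> A ` W"
    then obtain y where y: "y \<in> T" "u \<bullet> y = 0" "z = A y" unfolding W by auto
    have "u \<bullet> A y = ((A u \<bullet> u) *\<^sub>R u) \<bullet> y"
      using Suc.prems(3)[OF u(1) y(1)] u(3) by metis
    then show "z \<in> W" using y Suc.prems(2) unfolding W by auto
  qed
  have "\<exists>b l. orthonormal_family (dim W) b \<and> (\<forall>i<dim W. b i \<in> W \<and> A (b i) = l i *\<^sub>R b i)"
    using Suc.hyps(1)[OF dW[symmetric] sW AW] Suc.prems(3) W by blast
  then obtain b l where b: "orthonormal_family k b" 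
    "\<And>i. i < k \<Longrightarrow> b i \<in> T" "\<And>i. i < k \<Longrightarrow> u \<bullet> b i = 0" "\<And>i. i < k \<Longrightarrow> A (b i) = l i *\<^sub>R b i"
    unfolding dW unfolding W by auto
  let ?b = "b(k := u)" and ?l = "l(k := A u \<bullet> u)"
  have "orthonormal_family (Suc k) ?b"
    unfolding orthonormal_family_def
    using orthonormal_familyD[OF b(1)] b(3) u(2)
    by (auto simp: less_Suc_eq inner_commute norm_eq_1)
  moreover have "\<forall>i<Suc k. ?b i \<in> T \<and> A (?b i) = ?l i *\<^sub>R ?b i"
    using b(2,4) u by (auto simp: less_Suc_eq)
  ultimately show ?case unfolding Suc.hyps(2)[symmetric] by blast
qed

lemma diagonal_linear_expansion:
  fixes b :: "nat \<Rightarrow> 'a::euclidean_space"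
  assumes b: "orthonormal_family (dim T) b" "\<And>i. i < dim T \<Longrightarrow> b i \<in> T"
    and L: "linear L" "\<And>i. i < dim T \<Longrightarrow> L (b i) = l i *\<^sub>R b i" and x: "x \<in> T"
  shows "L x = (\<Sum>i<dim T. ((x \<bullet> b i) * l i) *\<^sub>R b i)"
proof -
  have "L x = L (\<Sum>i<dim T. (x \<bullet> b i) *\<^sub>R b i)"
    using orthonormal_family_expansion[OF b x] by simp
  also have "\<dots> = (\<Sum>i<dim T. (x \<bullet> b i) *\<^sub>R L (b i))"
    by (simp add: linear_sum[OF L(1)] linear_scale[OF L(1)])
  finally show ?thesis using L(2) by simp
qed

lemma orthonormal_family_coefficient:
  assumes "orthonormal_family m b" "j < m"
  shows "(\<Sum>i<m. a i *\<^sub>R b i) \<bullet> b j = a j"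
proof -
  have "(\<Sum>i<m. a i *\<^sub>R b i) \<bullet> b j = (\<Sum>i<m. if i = j then a i else 0)"
    unfolding inner_sum_left using orthonormal_familyD[OF assms(1)] assms(2)
    by (intro sum.cong) auto
  then show ?thesis using assms(2) by simp
qed

text \<open>The coefficient of an eigenvector for \<open>c\<close> along \<open>b i\<close> vanishes unless \<open>l i = c\<close>. This turns the
  multiplicities in the definition of the principal curvatures into a count of indices.\<close>

lemma dim_eigenspace:
  fixes b :: "nat \<Rightarrow> 'a::euclidean_space"
  assumes T: "subspace T" and b: "orthonormal_family (dim T) b" "\<And>i. i < dim T \<Longrightarrow> b i \<in> T"
    and L: "linear L" "\<And>i. i < dim T \<Longrightarrow> L (b i) = l i *\<^sub>R b i"
  shows "dim {w \<in> T. L w = c *\<^sub>R w} = card {i \<in> {..<dim T}. l i = c}"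
proof -
  let ?I = "{i \<in> {..<dim T}. l i = c}" and ?E = "{w \<in> T. L w = c *\<^sub>R w}"
  interpret L: linear L by (rule L(1))
  have "subspace ?E"
    using T by (auto simp: subspace_def L.add L.scale L.zero algebra_simps)
  then have "span (b ` ?I) \<subseteq> ?E"
    by (rule span_minimal[rotated]) (use b(2) L(2) in auto)
  moreover have "?E \<subseteq> span (b ` ?I)"
  proof
    fix w assume w: "w \<in> ?E"
    then have wT: "w \<in> T" by simp
    have coeff: "w \<bullet> b i = 0" if "i < dim T" "l i \<noteq> c" for i
    proof -
      have "(w \<bullet> b i) * l i = L w \<bullet> b i"
        using diagonal_linear_expansion[of T b L l w] b L wT
          orthonormal_family_coefficient[OF b(1) that(1), of "\<lambda>i. (w \<bullet> b i) * l i"] by simp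
      also have "\<dots> = c * (w \<bullet> b i)" using w by simp
      finally show ?thesis using that(2) by simp
    qed
    have "w = (\<Sum>i<dim T. (w \<bullet> b i) *\<^sub>R b i)"
      by (rule orthonormal_family_expansion[OF b wT])
    also have "\<dots> \<in> span (b ` ?I)"
    proof (rule span_sum)
      fix i assume "i \<in> {..<dim T}"
      then show "(w \<bullet> b i) *\<^sub>R b i \<in> span (b ` ?I)"
        using coeff[of i] by (cases "l i = c") (auto intro: span_scale span_base span_zero)
    qed
    finally show "w \<in> span (b ` ?I)" .
  qed
  ultimately have "?E = span (b ` ?I)" by blast
  then have "dim ?E = card (b ` ?I)"
    using orthonormal_family_independent[OF b(1), of ?I]
    by (metis (no_types, lifting) dim_span_eq_card_independent mem_Collect_eq subsetI)
  also have "\<dots> = card ?I"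
    by (intro card_image inj_on_subset[OF orthonormal_family_inj_on[OF b(1)]]) auto
  finally show ?thesis .
qed

text \<open>The matrix is \<open>Q D Q\<^sup>T\<close>, where \<open>D\<close> is diagonal and \<open>Q\<close> is the change from the frame \<open>b\<close> to \<open>e\<close>;
  for \<open>L = id\<close> the same factorisation gives \<open>(det Q)\<^sup>2 = 1\<close>. The frame \<open>e\<close> is arbitrary because both
  the volume density and the determinant of an operator are computed in frames about which nothing
  else is known.\<close>

lemma det_in_orthonormal_family:
  fixes b :: "nat \<Rightarrow> 'a::euclidean_space"
  assumes b: "orthonormal_family (dim T) b" "\<And>i. i < dim T \<Longrightarrow> b i \<in> T"
    and e: "orthonormal_family (dim T) e" "\<And>i. i < dim T \<Longrightarrow> e i \<in> T"
    and L: "linear L" "\<And>i. i < dim T \<Longrightarrow> L (b i) = l i *\<^sub>R b i"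
  shows "Determinant.det (Matrix.mat (dim T) (dim T) (\<lambda>(i, j). e i \<bullet> L (e j))) = (\<Prod>i<dim T. l i)"
proof -
  let ?m = "dim T"
  define Q where "Q = Matrix.mat ?m ?m (\<lambda>(i, k). e i \<bullet> b k)"
  define D where "D = (\<lambda>l::nat \<Rightarrow> real. Matrix.mat ?m ?m (\<lambda>(i, j). if i = j then l i else 0))"
  have Q: "Q \<in> carrier_mat ?m ?m" and Qt: "transpose_mat Q \<in> carrier_mat ?m ?m"
    and D: "\<And>l. D l \<in> carrier_mat ?m ?m"
    unfolding Q_def D_def by auto
  have detD: "Determinant.det (D l) = (\<Prod>i<?m. l i)" for l
  proof -
    have "Determinant.det (D l) = prod_list (diag_mat (D l))"
      by (rule det_upper_triangular[OF _ D]) (auto simp: upper_triangular_def D_def)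
    also have "\<dots> = (\<Prod>i<?m. l i)"
      unfolding prod_list_diag_prod by (simp add: D_def atLeast0LessThan)
    finally show ?thesis .
  qed
  have factor: "Matrix.mat ?m ?m (\<lambda>(i, j). e i \<bullet> M (e j)) = Q * (D l * transpose_mat Q)"
    if M: "linear M" "\<And>i. i < ?m \<Longrightarrow> M (b i) = l i *\<^sub>R b i" for M l
  proof (rule eq_matI)
    fix i j assume "i < dim_row (Q * (D l * transpose_mat Q))" "j < dim_col (Q * (D l * transpose_mat Q))"
    then have ij: "i < ?m" "j < ?m" unfolding Q_def by auto
    have DQ: "(D l * transpose_mat Q) $$ (k, j) = l k * (e j \<bullet> b k)" if "k < ?m" for k
    proof -
      have "(D l * transpose_mat Q) $$ (k, j) =
          (\<Sum>p\<in>{0..<?m}. (if k = p then l k else 0) * (e j \<bullet> b p))"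
        using that ij unfolding D_def Q_def by (simp add: scalar_prod_def)
      also have "\<dots> = (\<Sum>p\<in>{0..<?m}. if k = p then l k * (e j \<bullet> b k) else 0)"
        by (intro sum.cong) auto
      finally show ?thesis using that by simp
    qed
    have "(Q * (D l * transpose_mat Q)) $$ (i, j) =
        (\<Sum>k\<in>{0..<?m}. (e i \<bullet> b k) * (D l * transpose_mat Q) $$ (k, j))"
      using ij D[of l] Qt unfolding Q_def by (simp add: scalar_prod_def)
    also have "\<dots> = (\<Sum>k<?m. (e i \<bullet> b k) * (l k * (e j \<bullet> b k)))"
      by (simp add: DQ atLeast0LessThan)
    also have "\<dots> = e i \<bullet> M (e j)"
      using diagonal_linear_expansion[of T b M l "e j"] b M e(2)[OF ij(2)]
      by (simp add: inner_sum_right mult_ac)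
    finally show "Matrix.mat ?m ?m (\<lambda>(i, j). e i \<bullet> M (e j)) $$ (i, j) =
        (Q * (D l * transpose_mat Q)) $$ (i, j)" using ij by simp
  qed (auto simp: Q_def)
  have det_factor: "Determinant.det (Q * (D l * transpose_mat Q)) =
      (Determinant.det Q)\<^sup>2 * (\<Prod>i<?m. l i)" for l
    using det_mult[OF Q mult_carrier_mat[OF D Qt]] det_mult[OF D Qt] det_transpose[OF Q]
    by (simp add: detD power2_eq_square)
  have "Matrix.mat ?m ?m (\<lambda>(i, j). e i \<bullet> e j) = 1\<^sub>m ?m"
    using orthonormal_familyD[OF e(1)] by (intro eq_matI) auto
  then have "(Determinant.det Q)\<^sup>2 = 1"
    using factor[of "\<lambda>x. x" "\<lambda>_. 1"] det_factor[of "\<lambda>_. 1"] by (simp add: linear_ident)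
  then show ?thesis using factor[OF L] det_factor[of l] by simp
qed

text \<open>Expanding \<open>L u\<close> in the eigenbasis and exchanging the sums leaves \<open>\<Sum>u. (b i \<bullet> u)\<^sup>2 = 1\<close> as the
  coefficient of \<open>l i\<close>.\<close>

lemma trace_eq_sum_eigenvalues:
  fixes b :: "nat \<Rightarrow> 'a::euclidean_space"
  assumes b: "orthonormal_family DIM('a) b"
    and L: "linear L" "\<And>i. i < DIM('a) \<Longrightarrow> L (b i) = l i *\<^sub>R b i"
  shows "(\<Sum>u\<in>Basis. u \<bullet> L u) = (\<Sum>i<DIM('a). l i)"
proof -
  have "L u = (\<Sum>i<DIM('a). ((u \<bullet> b i) * l i) *\<^sub>R b i)" for u
    using diagonal_linear_expansion[of UNIV b L l u] b L by (simp add: dim_UNIV)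
  then have "(\<Sum>u\<in>Basis. u \<bullet> L u) = (\<Sum>u\<in>Basis. \<Sum>i<DIM('a). l i * ((b i \<bullet> u) * (b i \<bullet> u)))"
    by (simp add: inner_sum_right inner_commute mult_ac)
  also have "\<dots> = (\<Sum>i<DIM('a). l i * (b i \<bullet> b i))"
    by (subst sum.swap) (simp add: sum_distrib_left[symmetric] euclidean_inner[symmetric])
  finally show ?thesis using orthonormal_familyD[OF b] by simp
qed

section \<open>Continuity of operator inversion\<close>

definition inverse_blinfun :: "('a::euclidean_space \<Rightarrow>\<^sub>L 'a) \<Rightarrow> 'a \<Rightarrow>\<^sub>L 'a" where
  "inverse_blinfun B = Blinfun (inv_into UNIV (blinfun_apply B))"

lemma blinfun_apply_inverse_blinfun:
  assumes "bij (blinfun_apply B)"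
  shows "blinfun_apply (inverse_blinfun B) = inv_into UNIV (blinfun_apply B)"
proof -
  let ?J = "inv_into UNIV (blinfun_apply B)"
  have J: "?J y = z \<longleftrightarrow> y = B z" for y z
    using bij_inv_eq_iff[OF assms, of z y] by metis
  have BJ: "B (?J y) = y" for y using J[of y "?J y"] by simp
  have "linear ?J"
    by (rule linearI) (simp_all add: J BJ blinfun.add_right blinfun.scaleR_right)
  then show ?thesis unfolding inverse_blinfun_def
    by (simp add: bounded_linear_Blinfun_apply linear_conv_bounded_linear)
qed

text \<open>Everything follows from \<open>M\<^sup>-\<^sup>1 - B\<^sup>-\<^sup>1 = - B\<^sup>-\<^sup>1 (M - B) M\<^sup>-\<^sup>1\<close>. Used once it bounds \<open>M\<^sup>-\<^sup>1\<close> by twice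
  the bound for \<open>B\<^sup>-\<^sup>1\<close> when \<open>M\<close> is close to \<open>B\<close>; used again with this bound it makes the left-hand
  side small.\<close>

lemma continuous_on_inverse_blinfun:
  "continuous_on {B :: 'a::euclidean_space \<Rightarrow>\<^sub>L 'a. bij (blinfun_apply B)} inverse_blinfun"
proof (rule continuous_onI)
  fix B :: "'a \<Rightarrow>\<^sub>L 'a" and \<epsilon> :: real
  assume "B \<in> {B. bij (blinfun_apply B)}" and \<epsilon>: "\<epsilon> > 0"
  then have B: "bij (blinfun_apply B)" by simp
  define c where "c = norm (inverse_blinfun B) + 1"
  have c: "c > 0" unfolding c_def by (simp add: add_nonneg_pos)
  have bound: "norm (inverse_blinfun B x) \<le> c * norm x" for x
  proof -
    have "norm (inverse_blinfun B x) \<le> norm (inverse_blinfun B) * norm x"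
      by (rule norm_blinfun)
    also have "\<dots> \<le> c * norm x" unfolding c_def by (intro mult_right_mono) auto
    finally show ?thesis .
  qed
  define d where "d = min (1 / (2 * c)) (\<epsilon> / (2 * c * c))"
  have "dist (inverse_blinfun M) (inverse_blinfun B) \<le> \<epsilon>"
    if M: "bij (blinfun_apply M)" and close: "dist M B < d" for M
  proof -
    have nd: "norm (M - B) \<le> 1 / (2 * c)" "norm (M - B) \<le> \<epsilon> / (2 * c * c)"
      using close unfolding d_def dist_norm by auto
    have diff: "inverse_blinfun M x - inverse_blinfun B x =
        - inverse_blinfun B ((M - B) (inverse_blinfun M x))" for x
    proof -
      have 1: "M (inverse_blinfun M x) = x"
        unfolding blinfun_apply_inverse_blinfun[OF M] by (rule bij_inv_eq_iff[OF M, THEN iffD1]) simp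
      have 2: "inverse_blinfun B (B y) = y" for y
        unfolding blinfun_apply_inverse_blinfun[OF B] using B by (simp add: bij_is_inj)
      show ?thesis by (simp add: blinfun.diff_left blinfun.diff_right 1 2)
    qed
    have est: "norm (inverse_blinfun M x - inverse_blinfun B x) \<le>
        c * (norm (M - B) * norm (inverse_blinfun M x))" for x
    proof -
      have "norm (inverse_blinfun M x - inverse_blinfun B x) \<le>
          c * norm ((M - B) (inverse_blinfun M x))"
        unfolding diff using bound by simp
      also have "\<dots> \<le> c * (norm (M - B) * norm (inverse_blinfun M x))"
        using c norm_blinfun[of "M - B" "inverse_blinfun M x"] by (intro mult_left_mono) auto
      finally show ?thesis .
    qed
    have boundM: "norm (inverse_blinfun M x) \<le> 2 * c * norm x" for x
    proof -
      have "norm (inverse_blinfun M x) \<le>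
          norm (inverse_blinfun B x) + norm (inverse_blinfun M x - inverse_blinfun B x)"
        by (metis add.commute diff_add_cancel norm_triangle_ineq)
      also have "\<dots> \<le> c * norm x + c * (1 / (2 * c) * norm (inverse_blinfun M x))"
      proof (rule add_mono[OF bound])
        show "norm (inverse_blinfun M x - inverse_blinfun B x) \<le>
            c * (1 / (2 * c) * norm (inverse_blinfun M x))"
          using c by (intro order_trans[OF est] mult_left_mono mult_right_mono nd(1)) auto
      qed
      also have "\<dots> = c * norm x + norm (inverse_blinfun M x) / 2" using c by simp
      finally show ?thesis by simp
    qed
    have "norm (inverse_blinfun M - inverse_blinfun B) \<le> \<epsilon>"
    proof (rule norm_blinfun_bound)
      fix x
      have "norm ((inverse_blinfun M - inverse_blinfun B) x) \<le>
          c * (norm (M - B) * norm (inverse_blinfun M x))"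
        using est by (simp add: blinfun.diff_left)
      also have "\<dots> \<le> c * (\<epsilon> / (2 * c * c) * (2 * c * norm x))"
        using c \<epsilon> by (intro mult_left_mono mult_mono nd(2) boundM) auto
      also have "\<dots> = \<epsilon> * norm x" using c by simp
      finally show "norm ((inverse_blinfun M - inverse_blinfun B) x) \<le> \<epsilon> * norm x" .
    qed (use \<epsilon> in simp)
    then show ?thesis by (simp add: dist_norm)
  qed
  moreover have "d > 0" unfolding d_def using c \<epsilon> by simp
  ultimately show "\<exists>d>0. \<forall>M\<in>{B. bij (blinfun_apply B)}. dist M B < d \<longrightarrow>
      dist (inverse_blinfun M) (inverse_blinfun B) \<le> \<epsilon>" by blast
qed

section \<open>Differentiation along the sphere\<close>

lemma sphere_tangent_iff: "v \<in> sphere_tangent x \<longleftrightarrow> v \<bullet> x = 0"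
  by (simp add: sphere_tangent_def)

lemma subspace_sphere_tangent: "subspace (sphere_tangent x)"
  by (auto simp: subspace_def sphere_tangent_def inner_simps)

lemma sphere_inner_self: "x \<in> sphere 0 1 \<Longrightarrow> x \<bullet> x = 1"
  by (simp add: norm_eq_1)

text \<open>The sphere has no interior, so derivatives within it are not unique; but great circles through \<open>x\<close>
  lie in the sphere, and composing with them determines the derivative on tangent vectors.\<close>

lemma has_derivative_sphere_unique:
  fixes f :: "'a::euclidean_space \<Rightarrow> 'b::real_normed_vector"
  assumes x: "x \<in> sphere 0 1" and v: "v \<in> sphere_tangent x"
    and D: "(f has_derivative D) (at x within sphere 0 1)"
    and E: "(f has_derivative E) (at x within sphere 0 1)"
  shows "D v = E v"
proof (cases "v = 0")
  case True
  then show ?thesis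
    using D E by (simp add: has_derivative_bounded_linear bounded_linear.linear linear_0)
next
  case False
  define w where "w = v /\<^sub>R norm v"
  define c where "c = (\<lambda>t. cos t *\<^sub>R x + sin t *\<^sub>R w)"
  have w: "w \<bullet> x = 0" "x \<bullet> w = 0" "w \<bullet> w = 1"
    using v False by (simp_all add: w_def sphere_tangent_iff inner_commute dot_square_norm power2_eq_square)
  have "c t \<bullet> c t = (cos t)\<^sup>2 + (sin t)\<^sup>2" for t
    using w sphere_inner_self[OF x] by (simp add: c_def inner_simps power2_eq_square)
  then have cS: "range c \<subseteq> sphere 0 1" by (auto simp: norm_eq_1)
  have c0: "c 0 = x" by (simp add: c_def)
  have dc: "(c has_derivative (\<lambda>t. t *\<^sub>R w)) (at 0)"
    unfolding c_def by (auto intro!: derivative_eq_intros)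
  have comp: "((\<lambda>t. f (c t)) has_derivative (\<lambda>t. L (t *\<^sub>R w))) (at 0)"
    if "(f has_derivative L) (at x within sphere 0 1)" for L
    using has_derivative_in_compose[OF dc, of f L] has_derivative_subset[OF that cS]
    by (simp add: c0)
  have "(\<lambda>t. D (t *\<^sub>R w)) = (\<lambda>t. E (t *\<^sub>R w))"
    by (rule has_derivative_unique[OF comp[OF D] comp[OF E]])
  from fun_cong[OF this, of "norm v"] show ?thesis using False by (simp add: w_def)
qed

lemma sphere_diff_eq:
  fixes f :: "'a::euclidean_space \<Rightarrow> 'b::real_normed_vector"
  assumes "x \<in> sphere 0 1" "v \<in> sphere_tangent x" "(f has_derivative D) (at x within sphere 0 1)"
  shows "sphere_diff f x v = D v"
proof -
  have "(f has_derivative sphere_diff f x) (at x within sphere 0 1)"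
    unfolding sphere_diff_def using assms(3) frechet_derivative_works differentiable_def by blast
  then show ?thesis using has_derivative_sphere_unique assms by blast
qed

lemma has_derivative_on_submanifold:
  fixes M :: "'a::euclidean_space set" and f :: "'a \<Rightarrow> 'b::real_normed_vector"
  assumes "open U" "x \<in> U \<inter> M" "\<And>y. y \<in> U \<inter> M \<Longrightarrow> F y = f y"
    and "(F has_derivative D) (at x)"
  shows "(f has_derivative D) (at x within M)"
proof -
  obtain d where d: "d > 0" "ball x d \<subseteq> U" using assms(1,2) open_contains_ball by blast
  show ?thesis
    by (rule has_derivative_transform_within[OF has_derivative_at_withinI[OF assms(4)] d(1)])
      (use assms d in \<open>auto simp: dist_commute subset_iff\<close>)
qed

lemma C1_on_submanifoldE:
  assumes "C1_on_submanifold M f" "p \<in> M"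
  obtains U F F' where "open U" "p \<in> U" "continuous_on U F'"
    "\<And>y. y \<in> U \<Longrightarrow> (F has_derivative blinfun_apply (F' y)) (at y)"
    "\<And>y. y \<in> U \<inter> M \<Longrightarrow> F y = f y"
    "\<And>y. y \<in> U \<inter> M \<Longrightarrow> (f has_derivative blinfun_apply (F' y)) (at y within M)"
proof -
  obtain U F where U: "open U" "p \<in> U" "C1_on_open U F" and Ff: "\<forall>y\<in>U \<inter> M. F y = f y"
    using bspec[OF assms(1)[unfolded C1_on_submanifold_def] assms(2)] by (elim exE conjE)
  obtain F' where F': "\<forall>y\<in>U. (F has_derivative blinfun_apply (F' y)) (at y)" "continuous_on U F'"
    using U(3) unfolding C1_on_open_def by (elim exE conjE)
  have "(f has_derivative blinfun_apply (F' y)) (at y within M)" if "y \<in> U \<inter> M" for y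
    by (rule has_derivative_on_submanifold[of U y M F]) (use U Ff F' that in auto)
  then show ?thesis using that[of U F' F] U F' Ff by simp
qed

lemma C1_on_sphere_has_derivative:
  fixes f :: "'a::euclidean_space \<Rightarrow> 'b::real_normed_vector"
  assumes "C1_on_submanifold (sphere 0 1) f" "x \<in> sphere 0 1"
  shows "(f has_derivative sphere_diff f x) (at x within sphere 0 1)"
proof -
  obtain D where "(f has_derivative D) (at x within sphere 0 1)"
    by (rule C1_on_submanifoldE[OF assms]) (use assms(2) in blast)
  then show ?thesis
    unfolding sphere_diff_def using frechet_derivative_works differentiable_def by blast
qed

section \<open>Symmetry of the second derivative\<close>

text \<open>The second difference is the increment over \<open>[0, t]\<close> of \<open>\<phi> s = F (x + t v + s w) - F (x + s w)\<close>.
  By the mean value theorem it equals \<open>t \<phi>' s\<close> for some \<open>s\<close>, and expanding \<open>F'\<close> to first order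
  around \<open>x\<close> gives \<open>\<phi>' s = t F'' v w\<close> up to \<open>o(t)\<close>.\<close>

lemma second_difference_estimate:
  fixes F :: "'a::real_normed_vector \<Rightarrow> real" and F' :: "'a \<Rightarrow> 'a \<Rightarrow>\<^sub>L real"
  assumes U: "open U" "x \<in> U" and dF: "\<And>y. y \<in> U \<Longrightarrow> (F has_derivative F' y) (at y)"
    and ddF: "(F' has_derivative F'') (at x)" and e: "e > 0"
  shows "\<exists>d>0. \<forall>t. 0 < t \<and> t < d \<longrightarrow>
    \<bar>F (x + t *\<^sub>R v + t *\<^sub>R w) - F (x + t *\<^sub>R v) - F (x + t *\<^sub>R w) + F x - t\<^sup>2 * F'' v w\<bar> \<le> e * t\<^sup>2"
proof -
  interpret F'': bounded_linear F'' by (rule has_derivative_bounded_linear[OF ddF])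
  \<comment> \<open>The added \<open>1\<close> makes \<open>C\<close> positive even if \<open>v\<close> and \<open>w\<close> vanish.\<close>
  define C where "C = norm v + norm w + 1"
  have C: "C \<ge> 1" "norm v + norm w \<le> C" "norm w \<le> C" unfolding C_def by auto
  define \<epsilon> where "\<epsilon> = e / (2 * C * C)"
  have \<epsilon>: "\<epsilon> > 0" unfolding \<epsilon>_def using e C by simp
  obtain d1 where d1: "d1 > 0"
    "\<And>y. norm (y - x) < d1 \<Longrightarrow> norm (F' y - F' x - F'' (y - x)) \<le> \<epsilon> * norm (y - x)"
    using ddF \<epsilon> unfolding has_derivative_at_alt by blast
  obtain d2 where d2: "d2 > 0" "ball x d2 \<subseteq> U" using U open_contains_ball by blast
  define d where "d = min d1 d2 / C"
  have d: "d > 0" unfolding d_def using d1 d2 C by simp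
  have "\<bar>F (x + t *\<^sub>R v + t *\<^sub>R w) - F (x + t *\<^sub>R v) - F (x + t *\<^sub>R w) + F x - t\<^sup>2 * F'' v w\<bar>
      \<le> e * t\<^sup>2" if t: "0 < t" "t < d" for t
  proof -
    have tC: "t * C < d1" "t * C < d2" using t C unfolding d_def by (auto simp: field_simps)
    have small: "norm (a *\<^sub>R v + s *\<^sub>R w) \<le> t * C" if "0 \<le> a" "a \<le> t" "0 \<le> s" "s \<le> t" for a s
    proof -
      have "norm (a *\<^sub>R v + s *\<^sub>R w) \<le> a * norm v + s * norm w"
        using that by (intro order_trans[OF norm_triangle_ineq]) simp
      also have "\<dots> \<le> t * norm v + t * norm w"
        using that by (intro add_mono mult_right_mono) auto
      also have "\<dots> \<le> t * C" using t C by (simp add: distrib_left[symmetric])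
      finally show ?thesis .
    qed
    have inU: "x + (a *\<^sub>R v + s *\<^sub>R w) \<in> U" if "0 \<le> a" "a \<le> t" "0 \<le> s" "s \<le> t" for a s
    proof -
      have "dist (x + (a *\<^sub>R v + s *\<^sub>R w)) x < d2"
        using small[OF that] tC by (simp add: dist_norm)
      then show ?thesis using d2(2) by (auto simp: dist_commute)
    qed
    have F'_near: "norm (F' (x + (a *\<^sub>R v + s *\<^sub>R w)) - F' x - F'' (a *\<^sub>R v + s *\<^sub>R w)) \<le> \<epsilon> * (t * C)"
      if "0 \<le> a" "a \<le> t" "0 \<le> s" "s \<le> t" for a s
    proof -
      have "norm (F' (x + (a *\<^sub>R v + s *\<^sub>R w)) - F' x - F'' (a *\<^sub>R v + s *\<^sub>R w))
          \<le> \<epsilon> * norm (a *\<^sub>R v + s *\<^sub>R w)"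
        using d1(2)[of "x + (a *\<^sub>R v + s *\<^sub>R w)"] small[OF that] tC by simp
      also have "\<dots> \<le> \<epsilon> * (t * C)" using small[OF that] \<epsilon> by (intro mult_left_mono) auto
      finally show ?thesis .
    qed
    define \<phi> where "\<phi> = (\<lambda>s. F (x + (t *\<^sub>R v + s *\<^sub>R w)) - F (x + (0 *\<^sub>R v + s *\<^sub>R w)))"
    define \<phi>' where "\<phi>' = (\<lambda>s. F' (x + (t *\<^sub>R v + s *\<^sub>R w)) w - F' (x + (0 *\<^sub>R v + s *\<^sub>R w)) w)"
    have along: "((\<lambda>s. F (x + (a *\<^sub>R v + s *\<^sub>R w))) has_real_derivative
        F' (x + (a *\<^sub>R v + s *\<^sub>R w)) w) (at s)" if "0 \<le> a" "a \<le> t" "0 \<le> s" "s \<le> t" for a s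
    proof -
      have line: "((\<lambda>s. x + (a *\<^sub>R v + s *\<^sub>R w)) has_derivative (\<lambda>h. h *\<^sub>R w)) (at s)"
        by (auto intro!: derivative_eq_intros)
      have "((\<lambda>s. F (x + (a *\<^sub>R v + s *\<^sub>R w))) has_derivative
          (\<lambda>h. F' (x + (a *\<^sub>R v + s *\<^sub>R w)) (h *\<^sub>R w))) (at s)"
        by (rule has_derivative_compose[OF line dF[OF inU[OF that]]])
      then show ?thesis
        by (simp add: has_field_derivative_def blinfun.scaleR_right mult.commute[of _ "blinfun_apply _ _"])
    qed
    have "\<exists>s>0. s < t \<and> \<phi> t - \<phi> 0 = (t - 0) * \<phi>' s"
      using t(1) by (rule MVT2) (auto simp: \<phi>_def \<phi>'_def intro!: DERIV_diff along
          simp del: scaleR_zero_left)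
    then obtain s where s: "0 < s" "s < t" "\<phi> t - \<phi> 0 = t * \<phi>' s" by auto
    let ?p = "x + (t *\<^sub>R v + s *\<^sub>R w)" and ?q = "x + (0 *\<^sub>R v + s *\<^sub>R w)"
    let ?R = "(F' ?p - F' x - F'' (t *\<^sub>R v + s *\<^sub>R w)) - (F' ?q - F' x - F'' (0 *\<^sub>R v + s *\<^sub>R w))"
    have "\<phi>' s - t * F'' v w = ?R w"
      by (simp add: \<phi>'_def F''.add F''.scaleR blinfun.diff_left blinfun.add_left blinfun.scaleR_left)
    moreover have "\<bar>?R w\<bar> \<le> (2 * (\<epsilon> * (t * C))) * C"
    proof -
      have "norm ?R \<le> \<epsilon> * (t * C) + \<epsilon> * (t * C)"
        using s t by (intro order_trans[OF norm_triangle_ineq4] add_mono F'_near) auto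
      then have "norm ?R \<le> 2 * (\<epsilon> * (t * C))" by (simp only: mult_2)
      then have "norm ?R * norm w \<le> (2 * (\<epsilon> * (t * C))) * C"
        using C \<epsilon> t by (intro mult_mono) auto
      then show ?thesis using norm_blinfun[of ?R w] by simp
    qed
    moreover have "(2 * (\<epsilon> * (t * C))) * C = e * t"
      using C by (simp add: \<epsilon>_def field_simps)
    ultimately have est: "\<bar>\<phi>' s - t * F'' v w\<bar> \<le> e * t" by simp
    have "F (x + t *\<^sub>R v + t *\<^sub>R w) - F (x + t *\<^sub>R v) - F (x + t *\<^sub>R w) + F x - t\<^sup>2 * F'' v w
        = t * (\<phi>' s - t * F'' v w)"
      using s(3) by (simp add: \<phi>_def algebra_simps power2_eq_square)
    then show ?thesis using est t by (simp add: abs_mult power2_eq_square mult_left_mono)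
  qed
  then show ?thesis using d by blast
qed

text \<open>The second difference is symmetric in \<open>v\<close> and \<open>w\<close>, hence so is its leading term.\<close>

lemma second_derivative_symmetric:
  fixes F :: "'a::real_normed_vector \<Rightarrow> real" and F' :: "'a \<Rightarrow> 'a \<Rightarrow>\<^sub>L real"
  assumes U: "open U" "x \<in> U" and dF: "\<And>y. y \<in> U \<Longrightarrow> (F has_derivative F' y) (at y)"
    and ddF: "(F' has_derivative F'') (at x)"
  shows "F'' v w = F'' w v"
proof -
  have "\<bar>F'' v w - F'' w v\<bar> \<le> 0 + e" if e: "e > 0" for e
  proof -
    have half: "e / 2 > 0" using e by simp
    obtain d1 where d1: "d1 > 0" "\<And>t. 0 < t \<Longrightarrow> t < d1 \<Longrightarrow>
      \<bar>F (x + t *\<^sub>R v + t *\<^sub>R w) - F (x + t *\<^sub>R v) - F (x + t *\<^sub>R w) + F x - t\<^sup>2 * F'' v w\<bar> \<le> (e / 2) * t\<^sup>2"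
      using second_difference_estimate[OF U dF ddF half, of v w] by blast
    obtain d2 where d2: "d2 > 0" "\<And>t. 0 < t \<Longrightarrow> t < d2 \<Longrightarrow>
      \<bar>F (x + t *\<^sub>R w + t *\<^sub>R v) - F (x + t *\<^sub>R w) - F (x + t *\<^sub>R v) + F x - t\<^sup>2 * F'' w v\<bar> \<le> (e / 2) * t\<^sup>2"
      using second_difference_estimate[OF U dF ddF half, of w v] by blast
    define t where "t = min d1 d2 / 2"
    have t: "0 < t" "t < d1" "t < d2" unfolding t_def using d1(1) d2(1) by auto
    have swap: "x + t *\<^sub>R w + t *\<^sub>R v = x + t *\<^sub>R v + t *\<^sub>R w" by simp
    have "\<bar>t\<^sup>2 * F'' v w - t\<^sup>2 * F'' w v\<bar> \<le> 2 * ((e / 2) * t\<^sup>2)"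
      using d1(2)[OF t(1,2)] d2(2)[OF t(1,3)] unfolding swap by linarith
    also have "\<bar>t\<^sup>2 * F'' v w - t\<^sup>2 * F'' w v\<bar> = t\<^sup>2 * \<bar>F'' v w - F'' w v\<bar>"
      by (simp add: right_diff_distrib[symmetric] abs_mult)
    also have "2 * ((e / 2) * t\<^sup>2) = t\<^sup>2 * e" by simp
    finally show ?thesis using t(1) by simp
  qed
  then have "\<bar>F'' v w - F'' w v\<bar> \<le> 0"
    by (rule field_le_epsilon)
  then show ?thesis by simp
qed

section \<open>The Cahn-Hoffman map as a hedgehog\<close>

text \<open>A (generalised) hedgehog is a possibly singular hypersurface parametrised by its own unit normal.
  At a regular point its tangent space at \<open>f x\<close> is \<open>x\<^sup>\<bottom>\<close>, which is also the tangent space of the sphere at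
  \<open>x\<close>; the differential of \<open>f\<close> is then an endomorphism of \<open>x\<^sup>\<bottom>\<close> that inverts the differential of the Gauss
  map and is self-adjoint like it. The existence of the mean curvature and its integrability only
  depend on these properties, which also make sense at singular points.\<close>

definition hedgehog :: "('a::euclidean_space \<Rightarrow> 'a) \<Rightarrow> bool" where
  "hedgehog f \<longleftrightarrow> C1_on_submanifold (sphere 0 1) f \<and>
     (\<forall>x\<in>sphere 0 1. sphere_diff f x ` sphere_tangent x \<subseteq> sphere_tangent x \<and>
       (\<forall>v\<in>sphere_tangent x. \<forall>w\<in>sphere_tangent x. sphere_diff f x v \<bullet> w = v \<bullet> sphere_diff f x w))"

text \<open>Subtracting \<open>c (y \<bullet> y - 1) / 2\<close> does not change a function on the sphere but changes its derivative
  in the normal direction.\<close>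

lemma has_derivative_modulo_radial:
  fixes x :: "'a::euclidean_space"
  assumes x: "x \<in> sphere 0 1" and f: "(f has_derivative D) (at x within sphere 0 1)"
  shows "(f has_derivative (\<lambda>v. D v - (c * (x \<bullet> v)))) (at x within sphere 0 1)"
proof -
  have "((\<lambda>y. f y - c * (y \<bullet> y - 1) / 2) has_derivative (\<lambda>v. D v - (c * (x \<bullet> v))))
      (at x within sphere 0 1)"
    by (auto intro!: derivative_eq_intros f simp: inner_commute)
  then show ?thesis
    by (rule has_derivative_transform[OF x, rotated]) (simp add: sphere_inner_self[simplified])
qed

text \<open>The gradient is the tangential part of any vector that represents a derivative: the normal part
  can be removed without losing the derivative, and a tangent vector is determined by its inner
  products with tangent vectors.\<close>

lemma sphere_gradient_eq:
  fixes \<gamma> :: "'a::euclidean_space \<Rightarrow> real"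
  assumes x: "x \<in> sphere 0 1" and \<gamma>: "(\<gamma> has_derivative (\<lambda>v. g \<bullet> v)) (at x within sphere 0 1)"
  shows "sphere_gradient \<gamma> x = g - (g \<bullet> x) *\<^sub>R x"
proof -
  let ?h = "g - (g \<bullet> x) *\<^sub>R x"
  have h: "?h \<in> sphere_tangent x"
    using sphere_inner_self[OF x] by (simp add: sphere_tangent_iff inner_simps)
  have dh: "(\<gamma> has_derivative (\<lambda>v. ?h \<bullet> v)) (at x within sphere 0 1)"
    using has_derivative_modulo_radial[OF x \<gamma>, of "g \<bullet> x"] by (simp add: inner_diff_left)
  show ?thesis unfolding sphere_gradient_def
  proof (rule the_equality)
    fix k assume k: "k \<in> sphere_tangent x \<and> (\<gamma> has_derivative (\<lambda>v. k \<bullet> v)) (at x within sphere 0 1)"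
    have d: "k - ?h \<in> sphere_tangent x"
      by (rule subspace_diff[OF subspace_sphere_tangent _ h]) (use k in blast)
    then have "k \<bullet> (k - ?h) = ?h \<bullet> (k - ?h)"
      using has_derivative_sphere_unique[OF x d] k dh by blast
    then have "(k - ?h) \<bullet> (k - ?h) = 0" by (simp only: inner_diff_left[of k])
    then show "k = ?h" by simp
  qed (use h dh in blast)
qed

lemma inner_gradient:
  fixes \<phi> :: "'a::euclidean_space \<Rightarrow>\<^sub>L real"
  shows "(\<Sum>b\<in>Basis. \<phi> b *\<^sub>R b) \<bullet> v = \<phi> v"
proof -
  have "\<phi> v = \<phi> (\<Sum>b\<in>Basis. (v \<bullet> b) *\<^sub>R b)" by (simp add: euclidean_representation)
  also have "\<dots> = (\<Sum>b\<in>Basis. \<phi> b * (b \<bullet> v))"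
    unfolding blinfun.sum_right blinfun.scaleR_right
    by (intro sum.cong) (simp_all add: inner_commute)
  finally show ?thesis by (simp add: inner_sum_left)
qed

text \<open>If \<open>F\<close> is a local \<open>C\<^sup>2\<close> extension of \<open>\<gamma>\<close>, then the map is locally the restriction of
  \<open>X y = grad F y - (grad F y \<bullet> y) y + F y y\<close>. In the derivative of \<open>X\<close> the two terms
  \<open>(grad F y \<bullet> v) y\<close> cancel, and on a tangent vector \<open>v\<close> there remains the tangential part of
  \<open>Hess F v\<close> plus a multiple of \<open>v\<close>, which is self-adjoint because the Hessian is.\<close>

lemma hedgehog_cahn_hoffman:
  fixes \<gamma> :: "'a::euclidean_space \<Rightarrow> real"
  assumes \<gamma>: "C2_on_submanifold (sphere 0 1) \<gamma>"
  shows "hedgehog (cahn_hoffman \<gamma>)"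
proof -
  define ext where "ext = (\<lambda>p U X X'. open U \<and> p \<in> U \<and> continuous_on U X' \<and>
      (\<forall>y\<in>U. (X has_derivative blinfun_apply (X' y)) (at y)) \<and>
      (\<forall>y\<in>U \<inter> sphere 0 1. X y = cahn_hoffman \<gamma> y) \<and>
      (\<forall>y\<in>U \<inter> sphere 0 1. \<forall>v\<in>sphere_tangent y.
        X' y v \<in> sphere_tangent y \<and> (\<forall>w\<in>sphere_tangent y. X' y v \<bullet> w = v \<bullet> X' y w)))"
  have local_ext: "\<exists>U X X'. ext p U X X'"
    if p: "p \<in> sphere 0 1" for p
  proof -
    obtain U F F' F'' where U: "open U" "p \<in> U"
      and dF: "\<And>y. y \<in> U \<Longrightarrow> (F has_derivative blinfun_apply (F' y)) (at y)"
      and dF': "\<And>y. y \<in> U \<Longrightarrow> (F' has_derivative blinfun_apply (F'' y)) (at y)"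
      and cF'': "continuous_on U F''" and F\<gamma>: "\<And>y. y \<in> U \<inter> sphere 0 1 \<Longrightarrow> F y = \<gamma> y"
      using \<gamma> p unfolding C2_on_submanifold_def C2_on_open_def C1_on_open_def by metis
    have sym: "F'' y v w = F'' y w v" if "y \<in> U" for y v w
      by (rule second_derivative_symmetric[OF U(1) that dF dF'[OF that]])
    have cF: "continuous_on U F"
      by (intro continuous_at_imp_continuous_on ballI has_derivative_continuous[OF dF])
    have cF': "continuous_on U F'"
      by (intro continuous_at_imp_continuous_on ballI has_derivative_continuous[OF dF'])
    define G where "G = (\<lambda>y. \<Sum>b\<in>Basis. F' y b *\<^sub>R b)"
    have G: "G y \<bullet> v = F' y v" for y v
      unfolding G_def by (rule inner_gradient)
    define X where "X = (\<lambda>y. G y - F' y y *\<^sub>R y + F y *\<^sub>R y)"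
    define Q where "Q = (\<lambda>y v. (\<Sum>b\<in>Basis. F'' y v b *\<^sub>R b) - F'' y v y *\<^sub>R y + (F y - F' y y) *\<^sub>R v)"
    define X' where "X' = (\<lambda>y. Blinfun (Q y))"
    have "linear (Q y)" for y
      by (rule linearI)
        (simp_all add: Q_def blinfun.add_left blinfun.add_right blinfun.scaleR_left
          blinfun.scaleR_right algebra_simps sum.distrib scaleR_sum_right)
    then have X': "blinfun_apply (X' y) = Q y" for y
      unfolding X'_def by (simp add: bounded_linear_Blinfun_apply linear_conv_bounded_linear)
    have "(X has_derivative blinfun_apply (X' y)) (at y)" if "y \<in> U" for y
    proof -
      have 1: "((\<lambda>z. F' z b) has_derivative (\<lambda>v. F'' y v b)) (at y)" for b
        by (rule bounded_linear.has_derivative[OF blinfun.bounded_linear_left dF'[OF that]])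
      have 2: "(G has_derivative (\<lambda>v. \<Sum>b\<in>Basis. F'' y v b *\<^sub>R b)) (at y)"
        unfolding G_def by (intro has_derivative_sum has_derivative_scaleR_left 1)
      have 3: "((\<lambda>z. F' z z) has_derivative (\<lambda>v. F' y v + F'' y v y)) (at y)"
        by (rule bounded_bilinear.FDERIV[OF bounded_bilinear_blinfun_apply dF'[OF that]
              has_derivative_ident])
      have "(X has_derivative (\<lambda>v. (\<Sum>b\<in>Basis. F'' y v b *\<^sub>R b)
          - (F' y y *\<^sub>R v + (F' y v + F'' y v y) *\<^sub>R y) + (F y *\<^sub>R v + F' y v *\<^sub>R y))) (at y)"
        unfolding X_def
        by (rule has_derivative_add[OF has_derivative_diff[OF 2
              has_derivative_scaleR[OF 3 has_derivative_ident]]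
              has_derivative_scaleR[OF dF[OF that] has_derivative_ident]])
      then show ?thesis
        by (rule has_derivative_eq_rhs) (simp add: X' Q_def fun_eq_iff algebra_simps)
    qed
    moreover have "continuous_on U X'"
      by (rule continuous_on_blinfun_componentwise)
        (unfold X' Q_def, intro continuous_intros cF cF' cF'')
    moreover have "X y = cahn_hoffman \<gamma> y" if y: "y \<in> U \<inter> sphere 0 1" for y
    proof -
      have "(\<gamma> has_derivative (\<lambda>v. G y \<bullet> v)) (at y within sphere 0 1)"
        unfolding G using has_derivative_on_submanifold[OF U(1) y F\<gamma> dF] y by blast
      from sphere_gradient_eq[OF _ this] y
      show ?thesis unfolding X_def cahn_hoffman_def by (simp add: G F\<gamma>)
    qed
    moreover have "X' y v \<in> sphere_tangent y \<and> (\<forall>w\<in>sphere_tangent y. X' y v \<bullet> w = v \<bullet> X' y w)"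
      if y: "y \<in> U \<inter> sphere 0 1" and v: "v \<in> sphere_tangent y" for y v
    proof -
      have H: "(\<Sum>b\<in>Basis. F'' y v b *\<^sub>R b) \<bullet> w = F'' y v w" for v w
        by (rule inner_gradient)
      have Q: "Q y v \<bullet> w = F'' y v w - F'' y v y * (y \<bullet> w) + (F y - F' y y) * (v \<bullet> w)" for v w
        by (simp only: Q_def inner_diff_left inner_add_left inner_scaleR_left H)
      have "Q y v \<bullet> y = 0"
        using v sphere_inner_self[of y] y by (simp add: Q sphere_tangent_iff)
      moreover have "Q y v \<bullet> w = v \<bullet> Q y w" if "w \<in> sphere_tangent y" for w
        using sym[of y v w] y v that Q[of v w] Q[of w v]
        by (simp add: sphere_tangent_iff inner_commute)
      ultimately show ?thesis by (simp add: X' sphere_tangent_iff)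
    qed
    ultimately have "ext p U X X'" using U unfolding ext_def by blast
    then show ?thesis by blast
  qed
  have "C1_on_submanifold (sphere 0 1) (cahn_hoffman \<gamma>)"
    unfolding C1_on_submanifold_def C1_on_open_def
  proof
    fix p :: 'a assume "p \<in> sphere 0 1"
    then obtain U X X' where "ext p U X X'" using local_ext by blast
    then show "\<exists>U F. open U \<and> p \<in> U \<and>
        (\<exists>F'. (\<forall>x\<in>U. (F has_derivative blinfun_apply (F' x)) (at x)) \<and> continuous_on U F') \<and>
        (\<forall>x\<in>U \<inter> sphere 0 1. F x = cahn_hoffman \<gamma> x)"
      unfolding ext_def by (intro exI[of _ U] exI[of _ X] conjI exI[of _ X']) simp_all
  qed
  moreover have "sphere_diff (cahn_hoffman \<gamma>) x v \<in> sphere_tangent x \<and> (\<forall>w\<in>sphere_tangent x.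
      sphere_diff (cahn_hoffman \<gamma>) x v \<bullet> w = v \<bullet> sphere_diff (cahn_hoffman \<gamma>) x w)"
    if x: "x \<in> sphere 0 1" and v: "v \<in> sphere_tangent x" for x v
  proof -
    obtain U X X' where "ext x U X X'" using local_ext[OF x] by blast
    then have U: "open U" "x \<in> U" and dX: "(X has_derivative blinfun_apply (X' x)) (at x)"
      and X: "\<And>y. y \<in> U \<inter> sphere 0 1 \<Longrightarrow> X y = cahn_hoffman \<gamma> y"
      and X': "\<And>v. v \<in> sphere_tangent x \<Longrightarrow> X' x v \<in> sphere_tangent x"
        "\<And>v w. v \<in> sphere_tangent x \<Longrightarrow> w \<in> sphere_tangent x \<Longrightarrow> X' x v \<bullet> w = v \<bullet> X' x w"
      using x unfolding ext_def by auto
    have "(cahn_hoffman \<gamma> has_derivative blinfun_apply (X' x)) (at x within sphere 0 1)"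
      by (rule has_derivative_on_submanifold[OF U(1) _ X dX]) (use U x in auto)
    then have "sphere_diff (cahn_hoffman \<gamma>) x u = X' x u" if "u \<in> sphere_tangent x" for u
      using sphere_diff_eq[OF x that] by blast
    then show ?thesis using X' v by simp
  qed
  ultimately show ?thesis unfolding hedgehog_def by blast
qed

section \<open>Principal curvatures of a hedgehog\<close>

text \<open>The numbers \<open>l i\<close> are the principal radii of curvature with a sign. They are defined at singular
  points as well, where at least one of them is zero.\<close>

definition principal_frame ::
    "('a::euclidean_space \<Rightarrow> 'a) \<Rightarrow> 'a \<Rightarrow> (nat \<Rightarrow> 'a) \<Rightarrow> (nat \<Rightarrow> real) \<Rightarrow> bool" where
  "principal_frame f x b l \<longleftrightarrow> orthonormal_family (DIM('a) - 1) b \<and>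
     (\<forall>i<DIM('a) - 1. b i \<in> sphere_tangent x \<and> sphere_diff f x (b i) = l i *\<^sub>R b i)"

lemma dim_sphere_tangent:
  fixes x :: "'a::euclidean_space"
  assumes "x \<in> sphere 0 1"
  shows "dim (sphere_tangent x) = DIM('a) - 1"
proof -
  have "sphere_tangent x = {v. x \<bullet> v = 0}" by (auto simp: sphere_tangent_def inner_commute)
  moreover have "x \<noteq> 0" using assms by auto
  ultimately show ?thesis by (simp add: dim_hyperplane)
qed

lemma hedgehogD:
  assumes f: "hedgehog f" and x: "x \<in> sphere 0 1"
  shows hedgehog_has_derivative: "(f has_derivative sphere_diff f x) (at x within sphere 0 1)"
    and hedgehog_linear: "linear (sphere_diff f x)"
    and hedgehog_tangential: "v \<in> sphere_tangent x \<Longrightarrow> sphere_diff f x v \<in> sphere_tangent x"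
    and hedgehog_symmetric: "v \<in> sphere_tangent x \<Longrightarrow> w \<in> sphere_tangent x \<Longrightarrow>
      sphere_diff f x v \<bullet> w = v \<bullet> sphere_diff f x w"
proof -
  show d: "(f has_derivative sphere_diff f x) (at x within sphere 0 1)"
    using f x C1_on_sphere_has_derivative unfolding hedgehog_def by blast
  show "linear (sphere_diff f x)"
    by (rule bounded_linear.linear[OF has_derivative_bounded_linear[OF d]])
qed (use f x in \<open>unfold hedgehog_def, blast+\<close>)

lemma principal_frame_exists:
  assumes f: "hedgehog f" and x: "x \<in> sphere 0 1"
  shows "\<exists>b l. principal_frame f x b l"
  unfolding principal_frame_def dim_sphere_tangent[OF x, symmetric]
  by (rule spectral_theorem_subspace[OF hedgehog_linear[OF f x] subspace_sphere_tangent])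
    (use hedgehog_tangential[OF f x] hedgehog_symmetric[OF f x] in auto)

lemma principal_frameD:
  fixes f :: "'a::euclidean_space \<Rightarrow> 'a"
  assumes "principal_frame f x b l" "x \<in> sphere 0 1"
  shows "orthonormal_family (dim (sphere_tangent x)) b"
    "\<And>i. i < dim (sphere_tangent x) \<Longrightarrow> b i \<in> sphere_tangent x"
    "\<And>i. i < dim (sphere_tangent x) \<Longrightarrow> sphere_diff f x (b i) = l i *\<^sub>R b i"
  using assms unfolding principal_frame_def dim_sphere_tangent[OF assms(2)] by auto

lemma immersion_iff_radii_nonzero:
  fixes f :: "'a::euclidean_space \<Rightarrow> 'a"
  assumes f: "hedgehog f" and x: "x \<in> sphere 0 1" and frame: "principal_frame f x b l"
  shows "immersion_at f x \<longleftrightarrow> (\<forall>i<DIM('a) - 1. l i \<noteq> 0)"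
proof
  let ?A = "sphere_diff f x" and ?T = "sphere_tangent x"
  interpret A: linear ?A by (rule hedgehog_linear[OF f x])
  note b = principal_frameD[OF frame x]
  {
    assume imm: "immersion_at f x"
    show "\<forall>i<DIM('a) - 1. l i \<noteq> 0"
    proof (intro allI impI notI)
      fix i assume i: "i < DIM('a) - 1" "l i = 0"
      then have "?A (b i) = ?A 0" "b i \<in> ?T" "0 \<in> ?T"
        using b[unfolded dim_sphere_tangent[OF x]] by (simp_all add: A.zero sphere_tangent_iff)
      then have "b i = 0" using imm unfolding immersion_at_def by (meson inj_onD)
      then show False
        using orthonormal_familyD[OF b(1), of i i] i by (simp add: dim_sphere_tangent[OF x])
    qed
  next
    assume l: "\<forall>i<DIM('a) - 1. l i \<noteq> 0"
    have kernel: "v = 0" if v: "v \<in> ?T" "?A v = 0" for v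
    proof -
      have "v \<bullet> b i = 0" if i: "i < dim ?T" for i
      proof -
        have "(v \<bullet> b i) * l i = ?A v \<bullet> b i"
          using diagonal_linear_expansion[of ?T b ?A l v] b A.linear_axioms v(1)
            orthonormal_family_coefficient[OF b(1) i, of "\<lambda>i. (v \<bullet> b i) * l i"] by simp
        then show ?thesis using v(2) l i by (simp add: dim_sphere_tangent[OF x])
      qed
      then show ?thesis using orthonormal_family_expansion[OF b(1,2) v(1)] by simp
    qed
    have "inj_on ?A ?T"
    proof (rule inj_onI)
      fix v w assume "v \<in> ?T" "w \<in> ?T" "?A v = ?A w"
      then have "v - w = 0"
        using kernel[of "v - w"] subspace_diff[OF subspace_sphere_tangent[of x], of v w]
        by (simp add: A.diff)
      then show "v = w" by simp
    qed
    moreover have "f differentiable (at x within sphere 0 1)"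
      using hedgehog_has_derivative[OF f x] by (rule differentiableI)
    ultimately show "immersion_at f x" unfolding immersion_at_def by simp
  }
qed

text \<open>A local \<open>C\<^sup>1\<close> extension \<open>F\<close> of \<open>f\<close> need not have an invertible derivative, but its restriction to
  \<open>x\<^sup>\<bottom>\<close> is an injective endomorphism. Adding a multiple of \<open>(y \<bullet> y - 1) x\<close>, which is zero on the sphere,
  adjusts the derivative in the remaining direction. The inverse function theorem then provides a
  \<open>C\<^sup>1\<close> inverse in the ambient space; its restriction to the image is the normal field.\<close>

lemma local_unit_normal_exists:
  fixes f :: "'a::euclidean_space \<Rightarrow> 'a"
  assumes f: "hedgehog f" and x: "x \<in> sphere 0 1" and imm: "immersion_at f x"
  shows "\<exists>U N. local_unit_normal f x U N"
proof -
  have C1: "C1_on_submanifold (sphere 0 1) f" using f by (simp add: hedgehog_def)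
  obtain W F' F where W: "open W" "x \<in> W" and cF': "continuous_on W F'"
    and dF: "\<And>y. y \<in> W \<Longrightarrow> (F has_derivative blinfun_apply (F' y)) (at y)"
    and Ff: "\<And>y. y \<in> W \<inter> sphere 0 1 \<Longrightarrow> F y = f y"
    and df: "\<And>y. y \<in> W \<inter> sphere 0 1 \<Longrightarrow>
      (f has_derivative blinfun_apply (F' y)) (at y within sphere 0 1)"
    by (rule C1_on_submanifoldE[OF C1 x]) (rule that)
  \<comment> \<open>The \<open>x\<close>-component of \<open>G' x x\<close> becomes \<open>1\<close>.\<close>
  define k where "k = 1 - F' x x \<bullet> x"
  define G where "G = (\<lambda>y. F y + (k * (y \<bullet> y - 1) / 2) *\<^sub>R x)"
  define G' where "G' = (\<lambda>y. F' y + (blinfun_scaleR_left x o\<^sub>L blinfun_inner_right (k *\<^sub>R y)))"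
  have G': "G' y v = F' y v + (k * (y \<bullet> v)) *\<^sub>R x" for y v
    by (simp add: G'_def blinfun.add_left)
  have dG: "(G has_derivative blinfun_apply (G' y)) (at y)" if "y \<in> W" for y
  proof -
    have "((\<lambda>y. k * (y \<bullet> y - 1) / 2) has_derivative (\<lambda>v. k * (y \<bullet> v))) (at y)"
      by (auto intro!: derivative_eq_intros simp: inner_commute)
    from has_derivative_add[OF dF[OF that] has_derivative_scaleR_left[OF this, of x]]
    show ?thesis unfolding G_def by (rule has_derivative_eq_rhs) (simp add: G' fun_eq_iff)
  qed
  have cG': "continuous_on W G'"
    unfolding G'_def by (intro continuous_intros cF')
  have GS: "G y = f y" if "y \<in> W \<inter> sphere 0 1" for y
    using Ff[OF that] that by (simp add: G_def sphere_inner_self[simplified])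
  have inj: "inj (blinfun_apply (G' x))"
  proof -
    have "u = 0" if u: "G' x u = 0" for u
    proof -
      define t where "t = u \<bullet> x"
      define p where "p = u - t *\<^sub>R x"
      have xx: "x \<bullet> x = 1" by (rule sphere_inner_self[OF x])
      have p: "p \<in> sphere_tangent x" using xx by (simp add: p_def t_def sphere_tangent_iff inner_simps)
      have F'p: "F' x p = sphere_diff f x p"
        using sphere_diff_eq[OF x p df] W x by simp
      have "G' x u = F' x p + t *\<^sub>R F' x x + (k * t) *\<^sub>R x"
        by (simp add: G' p_def t_def blinfun.diff_right blinfun.scaleR_right inner_commute)
      then have "0 = (F' x p + t *\<^sub>R F' x x + (k * t) *\<^sub>R x) \<bullet> x" using u by simp
      also have "\<dots> = t"
        using hedgehog_tangential[OF f x p] xx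
        by (simp add: F'p inner_simps sphere_tangent_iff k_def algebra_simps)
      finally have t: "t = 0" by simp
      then have "sphere_diff f x p = sphere_diff f x 0"
        using u F'p linear_0[OF hedgehog_linear[OF f x]] by (simp add: G' p_def t_def inner_commute)
      moreover have "0 \<in> sphere_tangent x" by (simp add: sphere_tangent_iff)
      ultimately have "p = 0" using imm p unfolding immersion_at_def by (meson inj_onD)
      then show ?thesis using t by (simp add: p_def)
    qed
    then show ?thesis
      by (subst linear_injective_0[OF bounded_linear.linear[OF blinfun.bounded_linear_right]]) simp
  qed
  then have "bij (blinfun_apply (G' x))"
    using linear_inj_imp_surj[OF bounded_linear.linear[OF blinfun.bounded_linear_right]]
    by (simp add: bij_def)
  then have invG: "inverse_blinfun (G' x) o\<^sub>L G' x = id_blinfun"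
    by (intro blinfun_eqI) (simp add: blinfun_apply_inverse_blinfun inj)
  obtain U V N N' where U: "open U" "U \<subseteq> W" "x \<in> U" and V: "open V" "G x \<in> V"
    and hom: "homeomorphism U V G N"
    and dN: "\<And>y. y \<in> V \<Longrightarrow> (N has_derivative (N' y)) (at y)"
    and N': "\<And>y. y \<in> V \<Longrightarrow> N' y = inv_into UNIV (blinfun_apply (G' (N y)))"
    and bij: "\<And>y. y \<in> V \<Longrightarrow> bij (blinfun_apply (G' (N y)))"
    using inverse_function_theorem[OF W(1) dG cG' W(2) invG] by metis
  have C1N: "C1_on_open V N"
    unfolding C1_on_open_def
  proof (intro exI conjI ballI)
    fix y assume y: "y \<in> V"
    show "(N has_derivative blinfun_apply (inverse_blinfun (G' (N y)))) (at y)"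
      using dN[OF y] by (simp add: N'[OF y] blinfun_apply_inverse_blinfun[OF bij[OF y]])
  next
    have cN: "continuous_on V N" and NV: "N ` V = U" using hom by (auto simp: homeomorphism_def)
    have "continuous_on V (\<lambda>y. G' (N y))"
      by (rule continuous_on_compose2[OF cG' cN]) (use NV U in auto)
    then show "continuous_on V (\<lambda>y. inverse_blinfun (G' (N y)))"
      by (rule continuous_on_compose2[OF continuous_on_inverse_blinfun]) (use bij in auto)
  qed
  have Nf: "N (f y) = y" and fV: "f y \<in> V" if "y \<in> U \<inter> sphere 0 1" for y
  proof -
    have "y \<in> U" "G y = f y" using that U GS[of y] by auto
    then show "N (f y) = y" "f y \<in> V" using hom unfolding homeomorphism_def by (metis imageI)+
  qed
  have "local_unit_normal f x U N"
    unfolding local_unit_normal_def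
  proof (intro conjI ballI)
    show "C1_on_submanifold (f ` (U \<inter> sphere 0 1)) N"
      unfolding C1_on_submanifold_def
      by (intro ballI exI[of _ V] exI[of _ N]) (use V C1N fV in auto)
    fix y assume y: "y \<in> U \<inter> sphere 0 1"
    fix v assume "v \<in> sphere_tangent y"
    then show "N (f y) \<bullet> sphere_diff f y v = 0"
      using hedgehog_tangential[OF f, of y v] y Nf[OF y] by (simp add: sphere_tangent_iff inner_commute)
  qed (use U Nf in auto)
  then show ?thesis by blast
qed

text \<open>Differentiating \<open>N (f y) = y\<close>. On the tangent space the result does not depend on the choice of the
  neighbourhood and of the normal field, which is why the curvatures are well defined.\<close>

lemma differential_of_unit_normal:
  fixes f :: "'a::euclidean_space \<Rightarrow> 'a"
  assumes f: "hedgehog f" and x: "x \<in> sphere 0 1" and N: "local_unit_normal f x U N"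
  defines "dN \<equiv> frechet_derivative N (at (f x) within f ` (U \<inter> sphere 0 1))"
  shows "linear dN" and "v \<in> sphere_tangent x \<Longrightarrow> dN (sphere_diff f x v) = v"
proof -
  let ?M = "f ` (U \<inter> sphere 0 1)"
  have U: "open U" "x \<in> U" and Nf: "\<And>y. y \<in> U \<inter> sphere 0 1 \<Longrightarrow> N (f y) = y"
    and C1: "C1_on_submanifold ?M N"
    using N unfolding local_unit_normal_def by auto
  have fx: "f x \<in> ?M" using U x by blast
  obtain D where "(N has_derivative D) (at (f x) within ?M)"
    by (rule C1_on_submanifoldE[OF C1 fx]) (use fx in blast)
  then have dN: "(N has_derivative dN) (at (f x) within ?M)"
    unfolding dN_def using frechet_derivative_works differentiable_def by blast
  then show "linear dN" by (rule bounded_linear.linear[OF has_derivative_bounded_linear])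
  have "(f has_derivative sphere_diff f x) (at x within U \<inter> sphere 0 1)"
    by (rule has_derivative_subset[OF hedgehog_has_derivative[OF f x]]) auto
  from has_derivative_in_compose[OF this dN]
  have "((\<lambda>y. y) has_derivative (\<lambda>v. dN (sphere_diff f x v))) (at x within U \<inter> sphere 0 1)"
    by (rule has_derivative_transform[rotated 2]) (use U x Nf in auto)
  moreover have "at x within U \<inter> sphere 0 1 = at x within sphere 0 1"
    by (rule at_within_nhd[of x U]) (use U in auto)
  ultimately have "((\<lambda>y. y) has_derivative (\<lambda>v. dN (sphere_diff f x v))) (at x within sphere 0 1)"
    by simp
  then show "dN (sphere_diff f x v) = v" if "v \<in> sphere_tangent x"
    using has_derivative_sphere_unique[OF x that _ has_derivative_ident] by blast
qed

text \<open>\<open>- dN\<close> is minus the inverse of the differential of \<open>f\<close>, so it is diagonal in the same frame with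
  eigenvalues \<open>- 1 / l i\<close>.\<close>

lemma principal_curvatures_iff:
  fixes f :: "'a::euclidean_space \<Rightarrow> 'a"
  assumes f: "hedgehog f" and x: "x \<in> sphere 0 1" and imm: "immersion_at f x"
    and frame: "principal_frame f x b l"
  shows "principal_curvatures f x \<mu> \<longleftrightarrow>
    (\<forall>c. card {i \<in> {1..DIM('a) - 1}. \<mu> i = c} = card {i \<in> {..<DIM('a) - 1}. - 1 / l i = c})"
proof -
  let ?A = "sphere_diff f x" and ?T = "sphere_tangent x"
  interpret A: linear ?A by (rule hedgehog_linear[OF f x])
  note b = principal_frameD[OF frame x]
  have l: "l i \<noteq> 0" if "i < dim ?T" for i
    using imm that immersion_iff_radii_nonzero[OF f x frame] by (simp add: dim_sphere_tangent[OF x])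
  have image: "?A ` ?T = ?T"
  proof
    show "?T \<subseteq> ?A ` ?T"
    proof
      fix w assume w: "w \<in> ?T"
      let ?v = "\<Sum>i<dim ?T. ((w \<bullet> b i) / l i) *\<^sub>R b i"
      have "?A ?v = (\<Sum>i<dim ?T. (w \<bullet> b i) *\<^sub>R b i)"
        using b(3) l by (simp add: A.sum A.scale)
      then have "w = ?A ?v" using orthonormal_family_expansion[OF b(1,2) w] by simp
      moreover have "?v \<in> ?T"
        using b(2) by (intro subspace_sum subspace_scale subspace_sphere_tangent) auto
      ultimately show "w \<in> ?A ` ?T" by blast
    qed
  qed (use hedgehog_tangential[OF f x] in blast)
  have dim: "dim {w \<in> ?A ` ?T. - frechet_derivative N (at (f x) within f ` (U \<inter> sphere 0 1)) w = c *\<^sub>R w}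
      = card {i \<in> {..<DIM('a) - 1}. - 1 / l i = c}" if N: "local_unit_normal f x U N" for U N c
  proof -
    let ?dN = "frechet_derivative N (at (f x) within f ` (U \<inter> sphere 0 1))"
    note dN = differential_of_unit_normal[OF f x N]
    have "- ?dN (b i) = (- 1 / l i) *\<^sub>R b i" if i: "i < dim ?T" for i
    proof -
      have "l i *\<^sub>R ?dN (b i) = b i"
        using dN(2)[OF b(2)[OF i]] by (simp add: b(3)[OF i] linear_scale[OF dN(1)])
      then have "?dN (b i) = (1 / l i) *\<^sub>R b i"
        using l[OF i] by (metis divide_inverse_commute mult.right_neutral scaleR_left_imp_eq
            scaleR_scaleR scaleR_one right_inverse)
      then show ?thesis by simp
    qed
    moreover have "linear (\<lambda>w. - ?dN w)" by (rule linear_compose_neg[OF dN(1)])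
    ultimately show ?thesis
      using dim_eigenspace[OF subspace_sphere_tangent b(1,2), of "\<lambda>w. - ?dN w" "\<lambda>i. - 1 / l i" c]
      unfolding image by (simp add: dim_sphere_tangent[OF x])
  qed
  show ?thesis
  proof
    assume "principal_curvatures f x \<mu>"
    then obtain U N where N: "local_unit_normal f x U N"
      and card: "\<And>c. card {i \<in> {1..DIM('a) - 1}. \<mu> i = c} = dim {w \<in> ?A ` ?T.
        - frechet_derivative N (at (f x) within f ` (U \<inter> sphere 0 1)) w = c *\<^sub>R w}"
      unfolding principal_curvatures_def Let_def by (elim exE conjE) (rule that, assumption, blast)
    show "\<forall>c. card {i \<in> {1..DIM('a) - 1}. \<mu> i = c} = card {i \<in> {..<DIM('a) - 1}. - 1 / l i = c}"
      unfolding card dim[OF N] by simp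
  next
    assume card: "\<forall>c. card {i \<in> {1..DIM('a) - 1}. \<mu> i = c} =
      card {i \<in> {..<DIM('a) - 1}. - 1 / l i = c}"
    obtain U N where N: "local_unit_normal f x U N"
      using local_unit_normal_exists[OF f x imm] by blast
    show "principal_curvatures f x \<mu>"
      unfolding principal_curvatures_def Let_def
      by (intro exI[of _ U] exI[of _ N] conjI allI N) (simp only: dim[OF N] card)
  qed
qed

lemma sum_eq_if_card_fibres_eq:
  fixes \<mu> :: "'i \<Rightarrow> real" and \<rho> :: "'j \<Rightarrow> real"
  assumes "finite I" "finite J" and card: "\<And>c. card {i \<in> I. \<mu> i = c} = card {j \<in> J. \<rho> j = c}"
  shows "sum \<mu> I = sum \<rho> J"
proof -
  let ?C = "\<mu> ` I \<union> \<rho> ` J"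
  have fibres: "sum g K = (\<Sum>c\<in>?C. real (card {i \<in> K. g i = c}) * c)"
    if "finite K" "g ` K \<subseteq> ?C" for g :: "'k \<Rightarrow> real" and K
  proof -
    have "sum g K = (\<Sum>c\<in>?C. \<Sum>i\<in>{i \<in> K. g i = c}. g i)"
      by (rule sum.group[symmetric]) (use that assms in auto)
    also have "\<dots> = (\<Sum>c\<in>?C. real (card {i \<in> K. g i = c}) * c)"
      by (intro sum.cong refl) simp
    finally show ?thesis .
  qed
  show ?thesis using fibres[OF assms(1), of \<mu>] fibres[OF assms(2), of \<rho>] card by simp
qed

text \<open>A family \<open>\<mu>\<close> of principal curvatures is only determined up to order, but its sum is determined by
  the multiplicities; this gives both existence and uniqueness of the mean curvature.\<close>

lemma has_mean_curvature_iff: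
  fixes f :: "'a::euclidean_space \<Rightarrow> 'a"
  assumes f: "hedgehog f" and x: "x \<in> sphere 0 1" and imm: "immersion_at f x"
    and frame: "principal_frame f x b l"
  shows "has_mean_curvature f x h \<longleftrightarrow>
    h = (\<Sum>i<DIM('a) - 1. - 1 / l i) / real (DIM('a) - 1)"
proof -
  have pc: "card {i \<in> {1..DIM('a) - 1}. - 1 / l (i - 1) = c} =
      card {i \<in> {..<DIM('a) - 1}. - 1 / l i = c}" for c
  proof -
    have "{i \<in> {1..DIM('a) - 1}. - 1 / l (i - 1) = c} = Suc ` {i \<in> {..<DIM('a) - 1}. - 1 / l i = c}"
    proof (intro equalityI subsetI)
      fix i assume "i \<in> {i \<in> {1..DIM('a) - 1}. - 1 / l (i - 1) = c}"
      then show "i \<in> Suc ` {i \<in> {..<DIM('a) - 1}. - 1 / l i = c}"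
        by (intro image_eqI[of _ _ "i - 1"]) auto
    qed auto
    then show ?thesis by (simp add: card_image)
  qed
  have sum: "sum \<mu> {1..DIM('a) - 1} = (\<Sum>i<DIM('a) - 1. - 1 / l i)"
    if "principal_curvatures f x \<mu>" for \<mu>
    using that unfolding principal_curvatures_iff[OF f x imm frame]
    by (intro sum_eq_if_card_fibres_eq) auto
  have "principal_curvatures f x (\<lambda>i. - 1 / l (i - 1))"
    unfolding principal_curvatures_iff[OF f x imm frame] using pc by blast
  then show ?thesis unfolding has_mean_curvature_def using sum by metis
qed

section \<open>Mean curvature and volume density through one continuous operator field\<close>

text \<open>The differential at \<open>x\<close> acts on a space that varies with \<open>x\<close>. Extending it to the ambient space by
  \<open>x \<mapsto> x\<close> gives operators on a fixed space that depend continuously on \<open>x\<close> and have the principal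
  radii and \<open>1\<close> as eigenvalues. The volume density is the absolute value of their determinant, and
  the mean curvature is an affine function of the trace of their inverse; this shows that both are
  continuous at regular points, although the frames chosen at different points are unrelated.\<close>

definition normal_extension :: "('a::euclidean_space \<Rightarrow> 'a) \<Rightarrow> 'a \<Rightarrow> 'a \<Rightarrow>\<^sub>L 'a" where
  "normal_extension f x = Blinfun (\<lambda>v. sphere_diff f x (v - (v \<bullet> x) *\<^sub>R x) + (v \<bullet> x) *\<^sub>R x)"

lemma normal_extension_apply:
  assumes f: "hedgehog f" and x: "x \<in> sphere 0 1"
  shows "normal_extension f x v = sphere_diff f x (v - (v \<bullet> x) *\<^sub>R x) + (v \<bullet> x) *\<^sub>R x"
proof -
  interpret A: linear "sphere_diff f x" by (rule hedgehog_linear[OF f x])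
  have "linear (\<lambda>v. sphere_diff f x (v - (v \<bullet> x) *\<^sub>R x) + (v \<bullet> x) *\<^sub>R x)"
    by (rule linearI) (simp_all add: A.diff A.add A.scale inner_add_left algebra_simps)
  then show ?thesis unfolding normal_extension_def
    by (simp add: bounded_linear_Blinfun_apply linear_conv_bounded_linear)
qed

lemma continuous_on_normal_extension:
  fixes f :: "'a::euclidean_space \<Rightarrow> 'a"
  assumes f: "hedgehog f"
  shows "continuous_on (sphere 0 1) (normal_extension f)"
  unfolding continuous_on_eq_continuous_within
proof
  fix x :: 'a assume x: "x \<in> sphere 0 1"
  have C1: "C1_on_submanifold (sphere 0 1) f" using f by (simp add: hedgehog_def)
  obtain U F' where U: "open U" "x \<in> U" and cF': "continuous_on U F'"
    and df: "\<And>y. y \<in> U \<inter> sphere 0 1 \<Longrightarrow>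
      (f has_derivative blinfun_apply (F' y)) (at y within sphere 0 1)"
    by (rule C1_on_submanifoldE[OF C1 x]) (rule that)
  have eq: "normal_extension f y v = F' y (v - (v \<bullet> y) *\<^sub>R y) + (v \<bullet> y) *\<^sub>R y"
    if y: "y \<in> U \<inter> sphere 0 1" for y v
  proof -
    have yS: "y \<in> sphere 0 1" using y by simp
    have "v - (v \<bullet> y) *\<^sub>R y \<in> sphere_tangent y"
      using sphere_inner_self[OF yS] by (simp add: sphere_tangent_iff inner_simps)
    then show ?thesis
      using sphere_diff_eq[OF yS _ df[OF y]] by (simp add: normal_extension_apply[OF f yS])
  qed
  have "continuous_on (U \<inter> sphere 0 1) (\<lambda>y. normal_extension f y v)" for v
  proof -
    have "continuous_on (U \<inter> sphere 0 1) (\<lambda>y. F' y (v - (v \<bullet> y) *\<^sub>R y) + (v \<bullet> y) *\<^sub>R y)"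
      by (intro continuous_intros continuous_on_subset[OF cF']) auto
    then show ?thesis by (subst continuous_on_cong[OF refl eq])
  qed
  then have "continuous_on (U \<inter> sphere 0 1) (normal_extension f)"
    by (intro continuous_on_blinfun_componentwise)
  then have "continuous (at x within U \<inter> sphere 0 1) (normal_extension f)"
    using U x by (simp add: continuous_on_eq_continuous_within)
  moreover have "at x within U \<inter> sphere 0 1 = at x within sphere 0 1"
    by (rule at_within_nhd[of x U]) (use U in auto)
  ultimately show "continuous (at x within sphere 0 1) (normal_extension f)" by simp
qed

lemma normal_extension_eigenbasis:
  fixes f :: "'a::euclidean_space \<Rightarrow> 'a"
  assumes f: "hedgehog f" and x: "x \<in> sphere 0 1" and frame: "principal_frame f x b l"
  defines "b' \<equiv> b(DIM('a) - 1 := x)" and "l' \<equiv> l(DIM('a) - 1 := 1)"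
  shows "orthonormal_family DIM('a) b'"
    and "i < DIM('a) \<Longrightarrow> normal_extension f x (b' i) = l' i *\<^sub>R b' i"
proof -
  note b = principal_frameD[OF frame x, unfolded dim_sphere_tangent[OF x]]
  have xx: "x \<bullet> x = 1" by (rule sphere_inner_self[OF x])
  have bx: "b i \<bullet> x = 0" "x \<bullet> b i = 0" if "i < DIM('a) - 1" for i
    using b(2)[OF that] by (simp_all add: sphere_tangent_iff inner_commute)
  have less: "i < DIM('a) \<longleftrightarrow> i < DIM('a) - 1 \<or> i = DIM('a) - 1" for i
    using DIM_positive[where 'a='a] by linarith
  show "orthonormal_family DIM('a) b'"
    unfolding orthonormal_family_def less b'_def
    using orthonormal_familyD[OF b(1)] bx xx by auto
  have "sphere_diff f x 0 = 0" by (rule linear_0[OF hedgehog_linear[OF f x]])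
  then show "normal_extension f x (b' i) = l' i *\<^sub>R b' i" if "i < DIM('a)"
    using that b(3) bx xx unfolding less b'_def l'_def
    by (auto simp: normal_extension_apply[OF f x])
qed

text \<open>The determinant of an endomorphism, computed in one fixed enumeration of the standard basis.\<close>

definition operator_det :: "('a::euclidean_space \<Rightarrow>\<^sub>L 'a) \<Rightarrow> real" where
  "operator_det B = (let e = (SOME e. bij_betw e {..<DIM('a)} (Basis :: 'a set)) in
     Determinant.det (Matrix.mat DIM('a) DIM('a) (\<lambda>(i, j). e i \<bullet> B (e j))))"

lemma continuous_on_operator_det: "continuous_on UNIV (operator_det :: ('a::euclidean_space \<Rightarrow>\<^sub>L 'a) \<Rightarrow> real)"
proof -
  let ?e = "SOME e. bij_betw e {..<DIM('a)} (Basis :: 'a set)"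
  have det: "operator_det B = (\<Sum>p | p permutes {0..<DIM('a)}.
      signof p * (\<Prod>i = 0..<DIM('a). ?e i \<bullet> B (?e (p i))))" for B :: "'a \<Rightarrow>\<^sub>L 'a"
  proof -
    have "operator_det B = (\<Sum>p | p permutes {0..<DIM('a)}. signof p * (\<Prod>i = 0..<DIM('a).
        Matrix.mat DIM('a) DIM('a) (\<lambda>(i, j). ?e i \<bullet> B (?e j)) $$ (i, p i)))"
      unfolding operator_det_def Let_def by (rule det_def'[of _ "DIM('a)"]) simp
    also have "\<dots> = (\<Sum>p | p permutes {0..<DIM('a)}.
        signof p * (\<Prod>i = 0..<DIM('a). ?e i \<bullet> B (?e (p i))))"
    proof (intro sum.cong refl arg_cong2[where f="(*)"] prod.cong)
      fix p i assume "p \<in> {p. p permutes {0..<DIM('a)}}" "i \<in> {0..<DIM('a)}"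
      then have "p i < DIM('a)" "i < DIM('a)" using permutes_in_image[of p "{0..<DIM('a)}" i] by auto
      then show "Matrix.mat DIM('a) DIM('a) (\<lambda>(i, j). ?e i \<bullet> B (?e j)) $$ (i, p i) =
          ?e i \<bullet> B (?e (p i))" by simp
    qed
    finally show ?thesis .
  qed
  show ?thesis unfolding det by (intro continuous_intros)
qed

lemma operator_det_eq_prod_eigenvalues:
  fixes b :: "nat \<Rightarrow> 'a::euclidean_space" and B :: "'a \<Rightarrow>\<^sub>L 'a"
  assumes "orthonormal_family DIM('a) b" "\<And>i. i < DIM('a) \<Longrightarrow> B (b i) = l i *\<^sub>R b i"
  shows "operator_det B = (\<Prod>i<DIM('a). l i)"
proof -
  let ?e = "SOME e. bij_betw e {..<DIM('a)} (Basis :: 'a set)"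
  have "\<exists>e. bij_betw e {..<DIM('a)} (Basis :: 'a set)"
    by (metis finite_Basis ex_bij_betw_nat_finite atLeast0LessThan)
  then have e: "bij_betw ?e {..<DIM('a)} (Basis :: 'a set)" by (rule someI_ex)
  have "orthonormal_family DIM('a) ?e"
    unfolding orthonormal_family_def
  proof (intro allI impI)
    fix i j assume ij: "i < DIM('a)" "j < DIM('a)"
    then have "?e i \<in> Basis" "?e j \<in> Basis" "?e i = ?e j \<longleftrightarrow> i = j"
      using e by (auto simp: bij_betw_def inj_on_def)
    then show "?e i \<bullet> ?e j = (if i = j then 1 else 0)" by (simp add: inner_Basis)
  qed
  then show ?thesis
    using det_in_orthonormal_family[of "UNIV :: 'a set" b ?e "blinfun_apply B" l] assms
      bounded_linear.linear[OF blinfun.bounded_linear_right[of B]]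
    unfolding operator_det_def Let_def by (simp add: dim_UNIV)
qed

lemma operator_det_normal_extension:
  fixes f :: "'a::euclidean_space \<Rightarrow> 'a"
  assumes f: "hedgehog f" and x: "x \<in> sphere 0 1" and frame: "principal_frame f x b l"
  shows "operator_det (normal_extension f x) = (\<Prod>i<DIM('a) - 1. l i)"
proof -
  obtain n where n: "DIM('a) = Suc n" using DIM_positive[where 'a='a] by (metis Suc_pred)
  have "operator_det (normal_extension f x) = (\<Prod>i<DIM('a). (l(DIM('a) - 1 := 1)) i)"
    by (rule operator_det_eq_prod_eigenvalues[OF normal_extension_eigenbasis[OF f x frame]])
  also have "\<dots> = (\<Prod>i<DIM('a) - 1. l i)" unfolding n by simp
  finally show ?thesis .
qed

text \<open>By symmetry \<open>A v \<bullet> A w = v \<bullet> A (A w)\<close>, so the Gram matrix is the matrix of \<open>A\<^sup>2\<close>, whose eigenvalues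
  are the squares of the principal radii.\<close>

lemma volume_density_eq:
  fixes f :: "'a::euclidean_space \<Rightarrow> 'a"
  assumes f: "hedgehog f" and x: "x \<in> sphere 0 1" and frame: "principal_frame f x b l"
  shows "volume_density f x = (\<Prod>i<DIM('a) - 1. \<bar>l i\<bar>)"
proof -
  let ?n = "DIM('a) - 1" and ?A = "sphere_diff f x"
  note b = principal_frameD[OF frame x]
  let ?e = "SOME e. orthonormal_frame x e"
  have frame_iff: "orthonormal_frame x e \<longleftrightarrow>
      orthonormal_family ?n e \<and> (\<forall>i<?n. e i \<in> sphere_tangent x)" for e
    unfolding orthonormal_frame_def orthonormal_family_def by blast
  have "orthonormal_frame x b" using b unfolding frame_iff dim_sphere_tangent[OF x] by simp
  then have e: "orthonormal_frame x ?e" by (rule someI[where P = "orthonormal_frame x"])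
  have lin: "linear ?A" by (rule hedgehog_linear[OF f x])
  have "Matrix.mat ?n ?n (\<lambda>(i, j). ?A (?e i) \<bullet> ?A (?e j)) =
      Matrix.mat ?n ?n (\<lambda>(i, j). ?e i \<bullet> ?A (?A (?e j)))"
    using e hedgehog_symmetric[OF f x] hedgehog_tangential[OF f x] unfolding frame_iff
    by (intro eq_matI) auto
  moreover have "Determinant.det (Matrix.mat (dim (sphere_tangent x)) (dim (sphere_tangent x))
      (\<lambda>(i, j). ?e i \<bullet> ?A (?A (?e j)))) = (\<Prod>i<dim (sphere_tangent x). l i * l i)"
  proof (rule det_in_orthonormal_family[OF b(1,2)])
    show "linear (\<lambda>v. ?A (?A v))" using linear_compose[OF lin lin] by (simp add: o_def)
    show "?A (?A (b i)) = (l i * l i) *\<^sub>R b i" if "i < dim (sphere_tangent x)" for i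
      by (simp add: b(3)[OF that] linear_scale[OF lin])
  qed (use e in \<open>simp_all add: frame_iff dim_sphere_tangent[OF x]\<close>)
  ultimately show ?thesis
    unfolding volume_density_def Let_def
    by (simp add: dim_sphere_tangent[OF x] prod.distrib abs_prod[symmetric])
qed

lemma regular_iff_operator_det_nonzero:
  fixes f :: "'a::euclidean_space \<Rightarrow> 'a"
  assumes f: "hedgehog f" and x: "x \<in> sphere 0 1"
  shows "immersion_at f x \<longleftrightarrow> operator_det (normal_extension f x) \<noteq> 0"
proof -
  obtain b l where frame: "principal_frame f x b l" using principal_frame_exists[OF f x] by blast
  show ?thesis
    unfolding immersion_iff_radii_nonzero[OF f x frame] operator_det_normal_extension[OF f x frame]
    by auto
qed

lemma mean_curvature_eq:
  fixes f :: "'a::euclidean_space \<Rightarrow> 'a"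
  assumes f: "hedgehog f" and x: "x \<in> sphere 0 1" and imm: "immersion_at f x"
    and frame: "principal_frame f x b l"
  shows "mean_curvature f x = (\<Sum>i<DIM('a) - 1. - 1 / l i) / real (DIM('a) - 1)"
  unfolding mean_curvature_def has_mean_curvature_iff[OF f x imm frame] by simp

text \<open>The eigenvalue \<open>1\<close> in the direction \<open>x\<close> contributes \<open>1\<close> to the trace of the inverse, and the
  tangential eigenvalues contribute \<open>- n H\<close>.\<close>

lemma mean_curvature_eq_trace:
  fixes f :: "'a::euclidean_space \<Rightarrow> 'a"
  assumes f: "hedgehog f" and x: "x \<in> sphere 0 1" and imm: "immersion_at f x"
  shows "bij (blinfun_apply (normal_extension f x))"
    and "mean_curvature f x =
      (1 - (\<Sum>u\<in>Basis. u \<bullet> inverse_blinfun (normal_extension f x) u)) / real (DIM('a) - 1)"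
proof -
  obtain b l where frame: "principal_frame f x b l" using principal_frame_exists[OF f x] by blast
  obtain n where n: "DIM('a) = Suc n" using DIM_positive[where 'a='a] by (metis Suc_pred)
  let ?B = "normal_extension f x"
  define b' where "b' = b(DIM('a) - 1 := x)"
  define l' where "l' = l(DIM('a) - 1 := 1)"
  note b' = normal_extension_eigenbasis[OF f x frame, folded b'_def l'_def]
  have linB: "linear (blinfun_apply ?B)"
    by (rule bounded_linear.linear, rule blinfun.bounded_linear_right)
  have l': "l' i \<noteq> 0" if "i < DIM('a)" for i
    using imm that unfolding immersion_iff_radii_nonzero[OF f x frame] l'_def n by auto
  have "v = 0" if v: "?B v = 0" for v
  proof -
    have "v \<bullet> b' i = 0" if i: "i < DIM('a)" for i
    proof -
      have "(v \<bullet> b' i) * l' i = ?B v \<bullet> b' i"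
        using diagonal_linear_expansion[of UNIV b' "blinfun_apply ?B" l' v] b' linB
          orthonormal_family_coefficient[OF b'(1) i, of "\<lambda>i. (v \<bullet> b' i) * l' i"]
        by (simp add: dim_UNIV)
      then show ?thesis using v l'[OF i] by simp
    qed
    then show ?thesis
      using orthonormal_family_expansion[of UNIV b' v] b'(1) by (simp add: dim_UNIV)
  qed
  then have "inj (blinfun_apply ?B)" by (subst linear_injective_0[OF linB]) blast
  then show bij: "bij (blinfun_apply ?B)"
    using linear_inj_imp_surj[OF linB] by (simp add: bij_def)
  let ?C = "inverse_blinfun ?B"
  have C: "?C (?B v) = v" for v
    by (simp add: blinfun_apply_inverse_blinfun[OF bij] bij_is_inj[OF bij])
  have "(\<Sum>u\<in>Basis. u \<bullet> ?C u) = (\<Sum>i<DIM('a). 1 / l' i)"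
  proof (rule trace_eq_sum_eigenvalues[OF b'(1)])
    show "linear (blinfun_apply ?C)"
      by (rule bounded_linear.linear, rule blinfun.bounded_linear_right)
    show "?C (b' i) = (1 / l' i) *\<^sub>R b' i" if i: "i < DIM('a)" for i
    proof -
      have "?C (b' i) = (1 / l' i) *\<^sub>R ?C (?B (b' i))"
        unfolding b'(2)[OF i] by (simp add: blinfun.scaleR_right l'[OF i])
      then show ?thesis by (simp only: C)
    qed
  qed
  also have "\<dots> = 1 - (\<Sum>i<DIM('a) - 1. - 1 / l i)"
    unfolding l'_def n by (simp add: sum_negf)
  finally show "mean_curvature f x =
      (1 - (\<Sum>u\<in>Basis. u \<bullet> ?C u)) / real (DIM('a) - 1)"
    unfolding mean_curvature_eq[OF f x imm frame] by simp
qed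

section \<open>Integrability\<close>

text \<open>The mean curvature can blow up where a principal radius tends to zero, but the volume density
  contains this radius as a factor: multiplied with the density, \<open>1 / l i\<close> becomes, up to sign, the
  product of all the other radii. The radii are bounded by the norm of the extended differential,
  which is continuous on the compact sphere.\<close>

lemma mean_curvature_times_density_bounded:
  fixes f :: "'a::euclidean_space \<Rightarrow> 'a"
  assumes f: "hedgehog f"
  shows "\<exists>K\<ge>0. \<forall>x\<in>sphere 0 1. immersion_at f x \<longrightarrow>
    \<bar>mean_curvature f x\<bar> * volume_density f x \<le> K"
proof -
  have "compact (normal_extension f ` sphere 0 1)"
    by (intro compact_continuous_image continuous_on_normal_extension f) simp
  then obtain C where C: "\<And>x. x \<in> sphere 0 1 \<Longrightarrow> norm (normal_extension f x) \<le> C"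
    using compact_imp_bounded by (force simp: bounded_iff)
  let ?n = "DIM('a) - 1"
  define K where "K = (\<Sum>i<?n. \<Prod>j\<in>{..<?n} - {i}. max C 0)"
  have "\<bar>mean_curvature f x\<bar> * volume_density f x \<le> K" if x: "x \<in> sphere 0 1" and imm: "immersion_at f x" for x
  proof -
    obtain b l where frame: "principal_frame f x b l" using principal_frame_exists[OF f x] by blast
    note b = principal_frameD[OF frame x, unfolded dim_sphere_tangent[OF x]]
    have l0: "l i \<noteq> 0" if "i < ?n" for i
      using imm that unfolding immersion_iff_radii_nonzero[OF f x frame] by blast
    have lC: "\<bar>l i\<bar> \<le> max C 0" if i: "i < ?n" for i
    proof -
      have nb: "norm (b i) = 1" using orthonormal_familyD[OF b(1) i i] by (simp add: norm_eq_1)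
      have "normal_extension f x (b i) = l i *\<^sub>R b i"
        using b(2,3)[OF i] by (simp add: normal_extension_apply[OF f x] sphere_tangent_iff)
      then have "\<bar>l i\<bar> = norm (normal_extension f x (b i))" using nb by simp
      also have "\<dots> \<le> norm (normal_extension f x)"
        using norm_blinfun[of "normal_extension f x" "b i"] nb by simp
      finally show ?thesis using C[OF x] by simp
    qed
    have "\<bar>mean_curvature f x\<bar> \<le> \<bar>\<Sum>i<?n. - 1 / l i\<bar>"
    proof (cases "?n = 0")
      case False
      then have "\<bar>s\<bar> / real ?n \<le> \<bar>s\<bar>" for s :: real
        by (simp add: divide_le_eq mult_left_le[of 1] mult_le_cancel_left1)
      then show ?thesis by (simp add: mean_curvature_eq[OF f x imm frame] abs_divide)
    qed (simp add: mean_curvature_eq[OF f x imm frame])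
    also have "\<dots> \<le> (\<Sum>i<?n. 1 / \<bar>l i\<bar>)"
      by (rule order_trans[OF sum_abs]) simp
    finally have "\<bar>mean_curvature f x\<bar> * volume_density f x \<le> (\<Sum>i<?n. 1 / \<bar>l i\<bar>) * (\<Prod>j<?n. \<bar>l j\<bar>)"
      unfolding volume_density_eq[OF f x frame] by (intro mult_right_mono prod_nonneg) auto
    also have "\<dots> = (\<Sum>i<?n. \<Prod>j\<in>{..<?n} - {i}. \<bar>l j\<bar>)"
      unfolding sum_distrib_right
    proof (rule sum.cong[OF refl])
      fix i assume i: "i \<in> {..<?n}"
      have "(\<Prod>j<?n. \<bar>l j\<bar>) = \<bar>l i\<bar> * (\<Prod>j\<in>{..<?n} - {i}. \<bar>l j\<bar>)"
        using i by (intro prod.remove) auto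
      then show "1 / \<bar>l i\<bar> * (\<Prod>j<?n. \<bar>l j\<bar>) = (\<Prod>j\<in>{..<?n} - {i}. \<bar>l j\<bar>)"
        using l0 i by simp
    qed
    also have "\<dots> \<le> K"
      unfolding K_def using lC by (intro sum_mono prod_mono) auto
    finally show ?thesis .
  qed
  moreover have "K \<ge> 0" unfolding K_def by (intro sum_nonneg prod_nonneg) auto
  ultimately show ?thesis by blast
qed

lemma sets_sphere_measure [simp]: "sets sphere_measure = sets borel"
  and space_sphere_measure [simp]: "space sphere_measure = UNIV"
  by (simp_all add: sphere_measure_def sets_scale_measure space_scale_measure)

lemma finite_measure_sphere_measure: "finite_measure (sphere_measure :: 'a::euclidean_space measure)"
proof (rule finite_measureI)
  let ?B = "cball 0 1 - {0} :: 'a set"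
  have B: "?B \<in> sets lborel" by simp
  have "(sgn :: 'a \<Rightarrow> 'a) \<in> borel_measurable borel"
    unfolding sgn_div_norm by measurable
  then have sgn: "(sgn :: 'a \<Rightarrow> 'a) \<in> borel_measurable (restrict_space lborel ?B)"
    by (intro measurable_restrict_space1) simp
  have "emeasure (distr (restrict_space lborel ?B) borel sgn) UNIV = emeasure lborel ?B"
    using B by (subst emeasure_distr[OF sgn]) (simp_all add: emeasure_restrict_space space_restrict_space)
  also have "\<dots> \<le> emeasure lborel (cball 0 1 :: 'a set)" by (rule emeasure_mono) auto
  also have "\<dots> < \<infinity>" by (rule emeasure_bounded_finite) simp
  finally have "emeasure sphere_measure (UNIV :: 'a set) < \<infinity>"
    unfolding sphere_measure_def by (simp add: ennreal_mult_less_top of_nat_less_top)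
  then show "emeasure sphere_measure (space sphere_measure :: 'a set) \<noteq> \<infinity>" by simp
qed

text \<open>The definition requires one limit along all exhaustions; for an absolutely integrable function it is
  the integral over the whole set, by dominated convergence.\<close>

lemma improper_integral_converges_if_integrable:
  fixes f :: "'a::t2_space \<Rightarrow> real"
  assumes sets: "sets M = sets borel" and int: "set_integrable M R f"
  shows "improper_integral_converges M R f"
proof -
  have compact: "K \<in> sets M" if "compact K" for K
    using that sets by (simp add: compact_imp_closed borel_closed)
  have "(\<lambda>j. set_lebesgue_integral M (K j) f) \<longlonglongrightarrow> set_lebesgue_integral M R f"
    if K: "compact_exhaustion R K" for K
  proof -
    have R: "(\<Union>j. K j) = R" and cK: "\<And>j. compact (K j)"
      using K unfolding compact_exhaustion_def by auto
    have "K j \<subseteq> K (Suc j)" for j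
      using K interior_of_subset[of "top_of_set R" "K (Suc j)"]
      unfolding compact_exhaustion_def by blast
    then have "incseq K" by (rule incseq_SucI)
    then show ?thesis
      using set_integral_cont_up[of K M f] compact[OF cK] int unfolding R by blast
  qed
  then show ?thesis
    unfolding improper_integral_converges_def
    using set_integrable_subset[OF int compact] by blast
qed

text \<open>A bounded measurable function is integrable for the finite surface measure of the sphere. With
  respect to the induced volume the function to consider is the product of mean curvature and
  density; both factors are continuous on the regular set, which is open in the sphere.\<close>

lemma set_integrable_mean_curvature:
  fixes f :: "'a::euclidean_space \<Rightarrow> 'a"
  assumes f: "hedgehog f"
  shows "set_integrable (induced_volume f) (sphere 0 1 - singular_set f) (mean_curvature f)"
proof -
  let ?R = "sphere 0 1 - singular_set f"
  let ?d = "\<lambda>x. indicator ?R x *\<^sub>R volume_density f x"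
  let ?H = "\<lambda>x. indicator ?R x *\<^sub>R mean_curvature f x"
  have R: "?R = {x \<in> sphere 0 1. immersion_at f x}" by (auto simp: singular_set_def)
  have cdet: "continuous_on (sphere 0 1) (\<lambda>x. operator_det (normal_extension f x))"
    by (rule continuous_on_compose2[OF continuous_on_operator_det continuous_on_normal_extension[OF f]]) simp
  have "closed (sphere 0 1 \<inter> (\<lambda>x. operator_det (normal_extension f x)) -` {0})"
    by (rule continuous_closed_preimage[OF cdet]) auto
  moreover have "?R = sphere 0 1 - (sphere 0 1 \<inter> (\<lambda>x. operator_det (normal_extension f x)) -` {0})"
    unfolding R using regular_iff_operator_det_nonzero[OF f] by auto
  ultimately have borelR: "?R \<in> sets borel" by (simp add: borel_closed sets.Diff)
  have RS: "?R \<subseteq> sphere 0 1" by auto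
  have "volume_density f x = \<bar>operator_det (normal_extension f x)\<bar>" if "x \<in> ?R" for x
  proof -
    have x: "x \<in> sphere 0 1" using that by simp
    obtain b l where frame: "principal_frame f x b l" using principal_frame_exists[OF f x] by blast
    show ?thesis
      by (simp add: volume_density_eq[OF f x frame] operator_det_normal_extension[OF f x frame] abs_prod)
  qed
  then have "continuous_on ?R (volume_density f) \<longleftrightarrow>
      continuous_on ?R (\<lambda>x. \<bar>operator_det (normal_extension f x)\<bar>)"
    by (rule continuous_on_cong[OF refl])
  then have "continuous_on ?R (volume_density f)"
    by (simp add: continuous_on_rabs continuous_on_subset[OF cdet RS])
  then have d_meas: "?d \<in> borel_measurable borel"
    by (rule borel_measurable_continuous_on_indicator[OF borelR])
  have cinv: "continuous_on ?R (\<lambda>x. inverse_blinfun (normal_extension f x))"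
    by (rule continuous_on_compose2[OF continuous_on_inverse_blinfun
          continuous_on_subset[OF continuous_on_normal_extension[OF f] RS]])
      (use mean_curvature_eq_trace(1)[OF f] in \<open>auto simp: singular_set_def\<close>)
  have "mean_curvature f x =
      (1 - (\<Sum>u\<in>Basis. u \<bullet> inverse_blinfun (normal_extension f x) u)) / real (DIM('a) - 1)"
    if "x \<in> ?R" for x
    by (rule mean_curvature_eq_trace(2)[OF f]) (use that in \<open>auto simp: singular_set_def\<close>)
  then have "continuous_on ?R (mean_curvature f) \<longleftrightarrow> continuous_on ?R (\<lambda>x.
      (1 - (\<Sum>u\<in>Basis. u \<bullet> inverse_blinfun (normal_extension f x) u)) / real (DIM('a) - 1))"
    by (rule continuous_on_cong[OF refl])
  moreover have "continuous_on ?R (\<lambda>x.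
      (1 - (\<Sum>u\<in>Basis. u \<bullet> inverse_blinfun (normal_extension f x) u)) / real (DIM('a) - 1))"
    unfolding divide_inverse by (intro continuous_intros cinv)
  ultimately have H_meas: "?H \<in> borel_measurable borel"
    by (intro borel_measurable_continuous_on_indicator[OF borelR]) simp
  obtain K where K: "K \<ge> 0" "\<And>x. x \<in> ?R \<Longrightarrow> \<bar>mean_curvature f x\<bar> * volume_density f x \<le> K"
    using mean_curvature_times_density_bounded[OF f] unfolding R by blast
  have d_nonneg: "volume_density f x \<ge> 0" if "x \<in> ?R" for x
  proof -
    have x: "x \<in> sphere 0 1" using that by simp
    obtain b l where frame: "principal_frame f x b l" using principal_frame_exists[OF f x] by blast
    show ?thesis by (simp add: volume_density_eq[OF f x frame] prod_nonneg)
  qed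
  have volume: "induced_volume f = density sphere_measure (\<lambda>x. ennreal (?d x))"
    unfolding induced_volume_def
    by (intro arg_cong[where f="density sphere_measure"]) (auto simp: fun_eq_iff indicator_def)
  have "integrable sphere_measure (\<lambda>x. ?d x *\<^sub>R ?H x)"
  proof (rule finite_measure.integrable_const_bound[OF finite_measure_sphere_measure])
    show "AE x in sphere_measure. norm (?d x *\<^sub>R ?H x) \<le> K"
      using K d_nonneg by (intro AE_I2) (auto simp: indicator_def abs_mult mult.commute)
    show "(\<lambda>x. ?d x *\<^sub>R ?H x) \<in> borel_measurable sphere_measure"
      using d_meas H_meas by (simp add: measurable_cong_sets[OF sets_sphere_measure refl])
  qed
  then show ?thesis
    unfolding set_integrable_def volume
    using d_meas H_meas d_nonneg
    by (subst integrable_density)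
      (auto simp: measurable_cong_sets[OF sets_sphere_measure refl] indicator_def)
qed

theorem theorem6p2:
  fixes \<gamma> :: "'a::euclidean_space \<Rightarrow> real" and n :: nat
  assumes "DIM('a) = n + 1" and "n \<ge> 1"
    and "\<forall>\<nu>\<in>sphere 0 1. \<gamma> \<nu> > 0"
    and "C2_on_submanifold (sphere 0 1) \<gamma>"
  shows "(\<forall>\<nu>\<in>sphere 0 1 - singular_set (cahn_hoffman \<gamma>).
            \<exists>!h. has_mean_curvature (cahn_hoffman \<gamma>) \<nu> h) \<and>
         improper_integral_converges (induced_volume (cahn_hoffman \<gamma>))
           (sphere 0 1 - singular_set (cahn_hoffman \<gamma>)) (mean_curvature (cahn_hoffman \<gamma>))"
proof (intro conjI ballI)
  have f: "hedgehog (cahn_hoffman \<gamma>)" by (rule hedgehog_cahn_hoffman[OF assms(4)])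
  have "sets (induced_volume (cahn_hoffman \<gamma>)) = sets borel"
    by (simp add: induced_volume_def)
  then show "improper_integral_converges (induced_volume (cahn_hoffman \<gamma>))
      (sphere 0 1 - singular_set (cahn_hoffman \<gamma>)) (mean_curvature (cahn_hoffman \<gamma>))"
    by (rule improper_integral_converges_if_integrable[OF _ set_integrable_mean_curvature[OF f]])
  fix \<nu> assume "\<nu> \<in> sphere 0 1 - singular_set (cahn_hoffman \<gamma>)"
  then have \<nu>: "\<nu> \<in> sphere 0 1" "immersion_at (cahn_hoffman \<gamma>) \<nu>" by (auto simp: singular_set_def)
  obtain b l where frame: "principal_frame (cahn_hoffman \<gamma>) \<nu> b l"
    using principal_frame_exists[OF f \<nu>(1)] by blast
  show "\<exists>!h. has_mean_curvature (cahn_hoffman \<gamma>) \<nu> h"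
    unfolding has_mean_curvature_iff[OF f \<nu> frame] by simp
qed

end
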